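(* Let $k\geq 2$, $n=rk$ with $r>2$, $e=\lceil r/2\rceil-1$. Let $\mathcal{C}_1=\bigcup_{i=1}^{e(q-1)(q^k-1)}\{\alpha U_i\mid\alpha\in\mathbb{F}_{q^n}^*\}$, $\mathcal{C}_2=\bigcup_{j=1}^{e(q-1)}\{\alpha V_j\mid\alpha\in\mathbb{F}_{q^n}^*\}$, and $\mathcal{C}_3=\{\alpha\mathbb{F}_{q^k}\mid\alpha\in\mathbb{F}_{q^n}^*\}$. Then $\mathcal{C}=\mathcal{C}_1\cup\mathcal{C}_2\cup\mathcal{C}_3$ is a cyclic constant dimension subspace code with cardinality $eq^k(q^n-1)+\frac{q^n-1}{q^k-1}$ and minimum distance $2k-2$.
   Context: $q$ is a prime power, $\mathbb{F}_{q^n}$ the degree-$n$ extension of $\mathbb{F}_q$; subspace distance $d(U,V)=\dim U+\dim V-2\dim(U\cap V)$; a code is cyclic if it is a union of orbits $\{\alpha U\mid\alpha\in\mathbb{F}_{q^n}^*\}$. Let $\xi$ be a primitive element of $\mathbb{F}_{q^k}$ and $G=\mathbb{F}_{q^k}^*/\langle\xi^{q-1}\rangle$ (cyclic of order $q-1$, elements used via fixed coset representatives). Let $\gamma$ be a root of an irreducible polynomial of degree $r$ over $\mathbb{F}_{q^k}$. The $U_i=\{u+(\tau_iu^q+u)\delta_i\gamma^{l_i}\mid u\in\mathbb{F}_{q^k}\}$ range over all $e(q-1)(q^k-1)$ triples $(\tau_i,\delta_i,l_i)$ with $\tau_i\in G$, $\delta_i\in\mathbb{F}_{q^k}^*$,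 $1\le l_i\le e$; the $V_j=\{u+\eta_ju^q\gamma^{l_j}\mid u\in\mathbb{F}_{q^k}\}$ range over all $e(q-1)$ pairs $(\eta_j,l_j)$ with $\eta_j\in G$, $1\le l_j\le e$. (Separately, $\mathcal{C}_1$ has size $e(q^k-1)(q^n-1)$ and $\mathcal{C}_2$ has size $e(q^n-1)$, each with minimum distance $2k-2$.) *)

theory Defs
  imports "HOL-Computational_Algebra.Primes" "HOL-Algebra.Embedded_Algebras" "HOL-Algebra.Polynomial_Divisibility"
begin

definition prime_power_nat :: "nat \<Rightarrow> bool" where
  "prime_power_nat q \<longleftrightarrow> (\<exists>p m. Factorial_Ring.prime p \<and> m > 0 \<and> q = p ^ m)"

text \<open>The field R plays the role of F_(q^n). For m a power of q dividing q^n, the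
  subfield F_m of R is the set of elements fixed by x maps to x^m.\<close>
definition subfield_of_order :: "('a, 'b) ring_scheme \<Rightarrow> nat \<Rightarrow> 'a set" where
  "subfield_of_order R m = {x \<in> carrier R. x [^]\<^bsub>R\<^esub> m = x}"

definition orbit :: "('a, 'b) ring_scheme \<Rightarrow> 'a set \<Rightarrow> 'a set set" where
  "orbit R U = {(\<lambda>u. \<alpha> \<otimes>\<^bsub>R\<^esub> u) ` U | \<alpha>. \<alpha> \<in> carrier R - {\<zero>\<^bsub>R\<^esub>}}"

definition cyclic_code :: "('a, 'b) ring_scheme \<Rightarrow> 'a set set \<Rightarrow> bool" where
  "cyclic_code R C \<longleftrightarrow> (\<exists>S. C = (\<Union>U\<in>S. orbit R U))"

definition constant_dim_code :: "('a, 'b) ring_scheme \<Rightarrow> 'a set \<Rightarrow> nat \<Rightarrow> 'a set set \<Rightarrow> bool" where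
  "constant_dim_code R F k C \<longleftrightarrow>
     (\<forall>U\<in>C. subalgebra F U R \<and> ring.dim R F U = k)"

definition subspace_dist :: "('a, 'b) ring_scheme \<Rightarrow> 'a set \<Rightarrow> 'a set \<Rightarrow> 'a set \<Rightarrow> int" where
  "subspace_dist R F U V =
     int (ring.dim R F U) + int (ring.dim R F V) - 2 * int (ring.dim R F (U \<inter> V))"

definition min_dist :: "('a, 'b) ring_scheme \<Rightarrow> 'a set \<Rightarrow> 'a set set \<Rightarrow> int" where
  "min_dist R F C = Min {subspace_dist R F U V | U V. U \<in> C \<and> V \<in> C \<and> U \<noteq> V}"

definition U_sub :: "('a, 'b) ring_scheme \<Rightarrow> nat \<Rightarrow> 'a set \<Rightarrow> 'a \<Rightarrow> 'a \<Rightarrow> 'a \<Rightarrow> nat \<Rightarrow> 'a set" where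
  "U_sub R q K \<gamma> \<tau> \<delta> l =
     {u \<oplus>\<^bsub>R\<^esub> (((\<tau> \<otimes>\<^bsub>R\<^esub> (u [^]\<^bsub>R\<^esub> q)) \<oplus>\<^bsub>R\<^esub> u) \<otimes>\<^bsub>R\<^esub> \<delta> \<otimes>\<^bsub>R\<^esub> (\<gamma> [^]\<^bsub>R\<^esub> l)) | u. u \<in> K}"

definition V_sub :: "('a, 'b) ring_scheme \<Rightarrow> nat \<Rightarrow> 'a set \<Rightarrow> 'a \<Rightarrow> 'a \<Rightarrow> nat \<Rightarrow> 'a set" where
  "V_sub R q K \<gamma> \<eta> l =
     {u \<oplus>\<^bsub>R\<^esub> (\<eta> \<otimes>\<^bsub>R\<^esub> (u [^]\<^bsub>R\<^esub> q) \<otimes>\<^bsub>R\<^esub> (\<gamma> [^]\<^bsub>R\<^esub> l)) | u. u \<in> K}"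

end

theory Submission
  imports Defs "HOL-Algebra.Finite_Extensions" "HOL-Algebra.Multiplicative_Group"
begin

text \<open>
  Every generator has the form \<open>{u + (a u + b u\<^sup>q) \<gamma>\<^sup>l | u \<in> K}\<close>: the spaces \<open>U\<close> have \<open>(a, b) = (\<delta>, \<tau>\<delta>)\<close>,
  the spaces \<open>V\<close> have \<open>(a, b) = (0, \<eta>)\<close>, and \<open>K\<close> itself has \<open>(a, b) = (0, 0)\<close>.
  If two shifts of such spaces share two vectors that are independent over \<open>F\<^sub>q\<close>, then cross-multiplying
  removes the shifts and leaves a polynomial relation in \<open>\<gamma>\<close> whose exponents \<open>0, l, m, l + m\<close> are below \<open>r\<close>.
  Comparing coefficients forces \<open>l = m\<close>, equal \<open>a\<close>, and values of \<open>b\<close> that differ by a \<open>(q - 1)\<close>-th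
  power \<open>z\<^bsup>q - 1\<^esup>\<close>; the choice of coset representatives then gives \<open>z \<in> F\<^sub>q\<close>, so the two shifted
  spaces coincide. Hence distinct codewords meet in dimension at most 1, which yields the
  distance, and the sizes of the orbits follow by counting the fibres of the parametrisation.
\<close>

section \<open>Subfields of a finite field\<close>

lemma (in cring) binomial_expansion:
  assumes x: "x \<in> carrier R" and y: "y \<in> carrier R"
  shows "(x \<oplus> y) [^] n = (\<Oplus>i\<in>{..n}. [(n choose i)] \<cdot> (x [^] i \<otimes> y [^] (n - i)))"
proof (induction n)
  case 0
  then show ?case by simp
next
  case (Suc n)
  define g where "g i = x [^] i \<otimes> y [^] (n - i)" for i
  have g: "g i \<in> carrier R" for i using x y by (simp add: g_def)
  have xy: "x [^] i \<otimes> x \<otimes> y [^] (n - i) = x \<otimes> g i" for i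
    using x y by (simp add: g_def m_assoc m_lcomm)
  have yg: "x [^] i \<otimes> y [^] (Suc n - i) = y \<otimes> g i" if "i \<le> n" for i
  proof -
    have "x [^] i \<otimes> y [^] (Suc n - i) = x [^] i \<otimes> (y \<otimes> y [^] (n - i))"
      using that y by (simp add: Suc_diff_le m_comm)
    then show ?thesis using x y by (simp add: g_def m_lcomm)
  qed
  have "(x \<oplus> y) [^] Suc n = (x \<oplus> y) \<otimes> (\<Oplus>i\<in>{..n}. [(n choose i)] \<cdot> g i)"
    using Suc x y by (simp add: g_def m_comm)
  also have "\<dots> = (\<Oplus>i\<in>{..n}. [(n choose i)] \<cdot> (x \<otimes> g i)) \<oplus> (\<Oplus>i\<in>{..n}. [(n choose i)] \<cdot> (y \<otimes> g i))"
    using x y g by (subst l_distr) (simp_all add: finsum_rdistr add_pow_rdistr Pi_def)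
  also have "(\<Oplus>i\<in>{..n}. [(n choose i)] \<cdot> (y \<otimes> g i))
      = (\<Oplus>i\<in>{..n}. [(n choose i)] \<cdot> (x [^] i \<otimes> y [^] (Suc n - i)))"
    using x y g by (intro finsum_cong') (auto simp: yg)
  \<comment> \<open>Extending the range is free because \<open>n choose Suc n\<close> is 0.
    Splitting off \<open>i = 0\<close> next aligns this sum with the first one for Pascal's
    rule.\<close>
  also have "\<dots> = (\<Oplus>i\<in>{..Suc n}. [(n choose i)] \<cdot> (x [^] i \<otimes> y [^] (Suc n - i)))"
    using x y by (subst finsum_Suc) (auto simp: Pi_def binomial_eq_0)
  also have "\<dots> = (\<Oplus>i\<in>{..n}. [(n choose Suc i)] \<cdot> (x \<otimes> g i)) \<oplus> y [^] Suc n"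
    using x y g by (subst finsum_Suc2) (auto simp: Pi_def xy)
  also have "(\<Oplus>i\<in>{..n}. [(n choose i)] \<cdot> (x \<otimes> g i)) \<oplus> \<dots>
     = (\<Oplus>i\<in>{..n}. [(n choose i)] \<cdot> (x \<otimes> g i) \<oplus> [(n choose Suc i)] \<cdot> (x \<otimes> g i)) \<oplus> y [^] Suc n"
    using x y g by (simp add: finsum_addf Pi_def a_assoc)
  also have "\<dots> = (\<Oplus>i\<in>{..n}. [(Suc n choose Suc i)] \<cdot> (x \<otimes> g i)) \<oplus> y [^] Suc n"
    using x g by (simp add: add.nat_pow_mult)
  also have "\<dots> = (\<Oplus>i\<in>{..Suc n}. [(Suc n choose i)] \<cdot> (x [^] i \<otimes> y [^] (Suc n - i)))"
    using x y g by (subst finsum_Suc2) (auto simp: Pi_def xy simp del: binomial_Suc_Suc)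
  finally show ?case .
qed

text \<open>The prime \<open>p\<close> divides \<open>p choose i\<close> for 0 < i < p, so the inner
  terms of the binomial expansion vanish.\<close>

lemma (in cring) frobenius_add:
  assumes p: "Factorial_Ring.prime (p::nat)" and char: "[(p::nat)] \<cdot> \<one> = \<zero>"
    and x: "x \<in> carrier R" and y: "y \<in> carrier R"
  shows "(x \<oplus> y) [^] p = x [^] p \<oplus> y [^] p"
proof -
  \<comment> \<open>With \<open>p = m + 2\<close> the inner indices 1, ..., p - 1 are exactly
    \<open>Suc i\<close> for \<open>i \<le> m\<close>, the form left once both ends of the sum are
    split off.\<close>
  obtain m where m: "Suc (Suc m) = p"
    using prime_ge_2_nat[OF p] by (metis add_2_eq_Suc le_Suc_ex)
  have zero: "[j] \<cdot> a = \<zero>" if a: "a \<in> carrier R" and "p dvd j" for a and j :: nat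
  proof -
    obtain i where j: "j = i * p" using \<open>p dvd j\<close> by (metis dvdE mult.commute)
    have "[p] \<cdot> a = ([p] \<cdot> \<one>) \<otimes> a" using a by (simp add: add_pow_ldistr)
    then have pa: "[p] \<cdot> a = \<zero>" using char a by simp
    have "[j] \<cdot> a = [i] \<cdot> ([p] \<cdot> a)" using a by (simp add: j add.nat_pow_pow mult.commute)
    then show ?thesis using pa by simp
  qed
  have mid: "(\<Oplus>i\<in>{..m}. [(p choose Suc i)] \<cdot> (x [^] Suc i \<otimes> y [^] (p - Suc i))) = \<zero>"
  proof -
    have "[(p choose Suc i)] \<cdot> (x [^] Suc i \<otimes> y [^] (p - Suc i)) = \<zero>" if "i \<le> m" for i
    proof (rule zero)
      show "p dvd (p choose Suc i)"
        using that m p by (intro dvd_choose_prime) auto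
    qed (use x y in auto)
    then have "(\<Oplus>i\<in>{..m}. [(p choose Suc i)] \<cdot> (x [^] Suc i \<otimes> y [^] (p - Suc i)))
        = (\<Oplus>i\<in>{..m}. \<zero>)"
      by (intro finsum_cong') auto
    then show ?thesis by simp
  qed
  have "(x \<oplus> y) [^] p = (\<Oplus>i\<in>{..Suc (Suc m)}. [(p choose i)] \<cdot> (x [^] i \<otimes> y [^] (p - i)))"
    using binomial_expansion[OF x y, of p] by (simp add: m)
  also have "\<dots> = x [^] p \<oplus> (\<Oplus>i\<in>{..Suc m}. [(p choose i)] \<cdot> (x [^] i \<otimes> y [^] (p - i)))"
    using x y by (subst finsum_Suc) (auto simp: Pi_def m)
  also have "\<dots> = x [^] p \<oplus> ((\<Oplus>i\<in>{..m}. [(p choose Suc i)] \<cdot> (x [^] Suc i \<otimes> y [^] (p - Suc i))) \<oplus> y [^] p)"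
    using x y by (subst finsum_Suc2) (auto simp: Pi_def)
  finally show ?thesis using mid x y by simp
qed

lemma (in cring) frobenius_power_add:
  assumes p: "Factorial_Ring.prime (p::nat)" and char: "[(p::nat)] \<cdot> \<one> = \<zero>"
    and x: "x \<in> carrier R" and y: "y \<in> carrier R"
  shows "(x \<oplus> y) [^] (p ^ m) = x [^] (p ^ m) \<oplus> y [^] (p ^ m)"
proof (induction m)
  case (Suc m)
  have "(x \<oplus> y) [^] (p ^ Suc m) = ((x \<oplus> y) [^] (p ^ m)) [^] p"
    using x y by (simp add: nat_pow_pow mult.commute[of p])
  also have "\<dots> = (x [^] (p ^ m)) [^] p \<oplus> (y [^] (p ^ m)) [^] p"
    using x y by (simp add: Suc frobenius_add[OF p char])
  finally show ?case using x y by (simp add: nat_pow_pow mult.commute[of p])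
qed (use x y in simp)

text \<open>Lagrange in the additive group kills \<open>[(p ^ m)] \<cdot> \<one>\<close>, which
  equals \<open>([p] \<cdot> \<one>) [^] m\<close>; a domain has no nonzero nilpotents.\<close>

lemma (in domain) finite_domain_char:
  assumes card: "card (carrier R) = p ^ m"
  shows "[p] \<cdot> \<one> = \<zero>"
proof -
  have "[(p ^ m)] \<cdot> \<one> = \<zero>"
    using add.pow_order_eq_1[of \<one>] card by (simp add: order_def)
  moreover have "[(p ^ j)] \<cdot> \<one> = ([p] \<cdot> \<one>) [^] j" for j
  proof (induction j)
    case (Suc j)
    have "[(p ^ Suc j)] \<cdot> \<one> = [p] \<cdot> ([(p ^ j)] \<cdot> \<one>)"
      by (simp add: add.nat_pow_pow mult.commute)
    also have "\<dots> = ([(p ^ j)] \<cdot> \<one>) \<otimes> ([p] \<cdot> \<one>)"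
      by (simp add: add_pow_rdistr)
    finally show ?case using Suc by simp
  qed simp
  moreover have "a = \<zero>" if "a \<in> carrier R" "a [^] j = \<zero>" for a and j :: nat
    using that by (induction j) (auto simp: integral_iff)
  ultimately show ?thesis by simp
qed

text \<open>Multiplicativity of the power map settles products and inverses. Additivity supplies
  sums and, applied to \<open>h\<close> and \<open>\<ominus> h\<close>, also negatives.\<close>

lemma (in field) subfield_of_order_is_subfield:
  assumes "m > 0"
    and add: "\<And>x y. x \<in> carrier R \<Longrightarrow> y \<in> carrier R \<Longrightarrow> (x \<oplus> y) [^] m = x [^] m \<oplus> y [^] m"
  shows "subfield (subfield_of_order R m) R"
proof (rule subfieldI'[OF subringI])
  have zm: "\<zero> [^] m = \<zero>" using \<open>m > 0\<close> by (simp add: nat_pow_zero)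
  show "\<ominus> h \<in> subfield_of_order R m" if "h \<in> subfield_of_order R m" for h
  proof -
    have h: "h \<in> carrier R" "h [^] m = h" using that by (auto simp: subfield_of_order_def)
    have "h \<oplus> (\<ominus> h) [^] m = \<zero>"
      using add[of h "\<ominus> h"] h zm by (simp add: r_neg)
    then have "(\<ominus> h) [^] m = \<ominus> h" using h
      by (metis a_inv_closed minus_equality nat_pow_closed a_comm)
    then show ?thesis using h by (simp add: subfield_of_order_def)
  qed
  show "inv k \<in> subfield_of_order R m" if "k \<in> subfield_of_order R m - {\<zero>}" for k
  proof -
    have k: "k \<in> Units R" "k [^] m = k" "k \<in> carrier R"
      using that by (auto simp: subfield_of_order_def field_Units)
    have "inv k [^] m = inv (k [^] m)"
    proof (rule sym, rule comm_inv_char)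
      show "k [^] m \<otimes> inv k [^] m = \<one>"
        using nat_pow_distrib[of k "inv k" m] k(1,3) by simp
    qed (use k in auto)
    then show ?thesis using k by (simp add: subfield_of_order_def)
  qed
qed (use add in \<open>auto simp: subfield_of_order_def nat_pow_distrib\<close>)

text \<open>With \<open>n = d * c\<close> this is the factorisation of \<open>x ^ c - 1\<close> at
  \<open>x = q ^ d\<close>, carried out over the integers, where subtraction is not
  truncated.\<close>

lemma power_sub_one_dvd:
  fixes q :: nat assumes "d dvd n" shows "(q ^ d - 1) dvd (q ^ n - 1)"
proof -
  obtain c where n: "n = d * c" using assms by blast
  have "(int q ^ d - 1) dvd ((int q ^ d) ^ c - 1)"
    by (simp add: power_diff_1_eq)
  show ?thesis
  proof (cases "q = 0")
    case False
    with \<open>(int q ^ d - 1) dvd ((int q ^ d) ^ c - 1)\<close>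
    have "int (q ^ d - 1) dvd int (q ^ n - 1)"
      by (simp add: of_nat_diff n power_mult Suc_leI)
    then show ?thesis by simp
  qed (use assms in \<open>auto simp: power_0_left\<close>)
qed

text \<open>The unit group is cyclic of order \<open>N = q ^ n - 1\<close>, and
  \<open>M = q ^ d - 1\<close> divides \<open>N\<close>. The nonzero fixed points are the solutions
  of \<open>x [^] M = \<one>\<close>, namely the \<open>M\<close> powers of \<open>g [^] c\<close>
  with \<open>c = N / M\<close>.\<close>

lemma (in field) card_subfield_of_order:
  assumes fin: "finite (carrier R)" and card: "card (carrier R) = q ^ n"
    and q: "q \<ge> 2" and dn: "d dvd n" and d: "d > 0" and n: "n > 0"
  shows "card (subfield_of_order R (q ^ d)) = q ^ d"
proof -
  interpret M: group "Multiplicative_Group.mult_of R" by (rule field_mult_group)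
  define N where "N = q ^ n - 1"
  define M where "M = q ^ d - 1"
  have qd: "q ^ d \<ge> 2" using self_le_power[of q d] q d by linarith
  have qn: "q ^ n \<ge> 2" using self_le_power[of q n] q n by linarith
  have M0: "M > 0" "N > 0" using qd qn by (auto simp: M_def N_def)
  have "M dvd N" unfolding M_def N_def by (rule power_sub_one_dvd[OF dn])
  then obtain c where c: "N = M * c" by blast
  then have c0: "c > 0" using M0 by (cases c) auto
  obtain g where g: "g \<in> carrier (Multiplicative_Group.mult_of R)"
    and gen: "carrier (Multiplicative_Group.mult_of R) = {g [^] i | i::nat. i \<in> UNIV}"
    using finite_field_mult_group_has_gen[OF fin] by blast
  have ordg: "M.ord g = N"
  proof -
    have "M.ord g = card (generate (Multiplicative_Group.mult_of R) {g})" by (rule M.generate_pow_card[OF g])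
    also have "generate (Multiplicative_Group.mult_of R) {g} = carrier (Multiplicative_Group.mult_of R)"
      using M.generate_pow_on_finite_carrier[OF _ g] fin gen by (simp add: Multiplicative_Group.nat_pow_mult_of)
    finally show ?thesis using fin card by (simp add: N_def card_Diff_singleton)
  qed
  have gpow: "g [^] i = \<one> \<longleftrightarrow> N dvd i" for i :: nat
    using M.pow_eq_id[OF g, of i] ordg by (simp add: Multiplicative_Group.nat_pow_mult_of)
  have gc: "g \<in> carrier R" "g \<noteq> \<zero>" using g by auto
  let ?S = "subfield_of_order R (q ^ d) - {\<zero>}"
  have mem: "x \<in> ?S \<longleftrightarrow> x \<in> carrier R - {\<zero>} \<and> x [^] M = \<one>" for x
  proof (cases "x \<in> carrier R - {\<zero>}")
    case True
    have "q ^ d = Suc M" using qd by (simp add: M_def)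
    then have "x [^] (q ^ d) = x [^] M \<otimes> x" by simp
    moreover have "x [^] M \<otimes> x = \<one> \<otimes> x \<longleftrightarrow> x [^] M = \<one>"
      using True by (intro m_rcancel) auto
    ultimately show ?thesis using True by (simp add: subfield_of_order_def)
  qed (auto simp: subfield_of_order_def)
  have "?S = (\<lambda>i. g [^] (c * i)) ` {..<M}"
  proof (intro subset_antisym subsetI)
    fix x assume "x \<in> ?S"
    then have x: "x \<in> carrier (Multiplicative_Group.mult_of R)" "x [^] M = \<one>" using mem by auto
    then obtain i :: nat where i: "x = g [^] i" using gen by auto
    have "N dvd i * M" using x i gc gpow[of "i * M"] by (simp add: nat_pow_pow)
    then have "c dvd i" using c M0 by (simp add: mult.commute)
    then obtain j where j: "i = c * j" by blast
    \<comment> \<open>The exponent may be reduced because \<open>c * M = N\<close> is the order of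
      \<open>g\<close>.\<close>
    have "x = g [^] (c * (j mod M))"
    proof -
      have "c * j = c * (j mod M) + N * (j div M)"
        unfolding c by (metis mult.assoc mult.commute distrib_left mod_mult_div_eq)
      then have "x = g [^] (c * (j mod M)) \<otimes> g [^] (N * (j div M))"
        using i j gc by (simp add: nat_pow_mult)
      then show ?thesis using gc gpow[of "N * (j div M)"] by simp
    qed
    then show "x \<in> (\<lambda>i. g [^] (c * i)) ` {..<M}" using M0 by auto
  next
    fix x assume "x \<in> (\<lambda>i. g [^] (c * i)) ` {..<M}"
    then obtain i where i: "x = g [^] (c * i)" by auto
    have "x \<in> carrier (Multiplicative_Group.mult_of R)" using gen i by auto
    moreover have "x [^] M = \<one>" using i gc gpow[of "c * i * M"] c by (simp add: nat_pow_pow mult.commute)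
    ultimately show "x \<in> ?S" using mem by auto
  qed
  moreover have "inj_on (\<lambda>i. g [^] (c * i)) {..<M}"
  proof (rule inj_onI)
    fix i j assume *: "i \<in> {..<M}" "j \<in> {..<M}" "g [^] (c * i) = g [^] (c * j)"
    have "c * i < N" "c * j < N" using * c c0 by auto
    then have "c * i = c * j"
      using inj_onD[OF M.ord_inj[OF g], of "c * i" "c * j"] *(3) M0 fin
      by (simp add: ordg Multiplicative_Group.nat_pow_mult_of)
    then show "i = j" using c0 by simp
  qed
  ultimately have "card ?S = M" by (simp add: card_image)
  moreover have "\<zero> \<in> subfield_of_order R (q ^ d)"
    using nat_pow_zero[of "q ^ d"] q by (simp add: subfield_of_order_def)
  moreover have "finite (subfield_of_order R (q ^ d))"
    using fin by (auto simp: subfield_of_order_def)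
  ultimately show ?thesis using qd by (simp add: card_Diff_singleton M_def)
qed

section \<open>Dimension and cardinality\<close>

text \<open>Coordinates in a basis identify \<open>E\<close> with the lists of length
  \<open>m\<close> over \<open>F\<close>.\<close>

lemma (in ring) card_dimension:
  assumes "subfield F R" "dimension m F E" "finite F"
  shows "card E = card F ^ m"
proof -
  obtain Vs where Vs: "set Vs \<subseteq> carrier R" "independent F Vs" "length Vs = m" "Span F Vs = E"
    using exists_base[OF assms(1,2)] by blast
  let ?L = "{Ks. set Ks \<subseteq> F \<and> length Ks = m}"
  have "bij_betw (\<lambda>Ks. combine Ks Vs) ?L E"
    unfolding bij_betw_def
  proof
    have E: "E = (\<lambda>Ks. combine Ks Vs) ` ?L"
      using Span_eq_combine_set_length_version[OF assms(1) Vs(1)] Vs(3,4) by auto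
    then show "(\<lambda>Ks. combine Ks Vs) ` ?L = E" by simp
    show "inj_on (\<lambda>Ks. combine Ks Vs) ?L"
    proof (rule inj_onI)
      fix Ks Ls assume *: "Ks \<in> ?L" "Ls \<in> ?L" "combine Ks Vs = combine Ls Vs"
      then have "combine Ks Vs \<in> Span F Vs" using E Vs(4) by blast
      from unique_decomposition[OF assms(1) Vs(2) this] show "Ks = Ls"
        using * Vs(3) by auto
    qed
  qed
  then have "card E = card ?L" by (simp add: bij_betw_same_card)
  then show ?thesis by (simp add: card_lists_length_eq assms(3))
qed

text \<open>A list of all elements of \<open>E\<close> spans it, so a finite dimension exists and
  \<open>dim\<close> denotes it.\<close>

lemma (in ring) finite_subalgebra_dimension:
  assumes F: "subfield F R" and E: "subalgebra F E R" and fin: "finite E"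
  shows "dimension (dim F E) F E"
proof -
  obtain Us where Us: "set Us = E" using fin finite_list by blast
  have sub: "E \<subseteq> carrier R" using subalgebra_in_carrier[OF E] .
  have "Span F Us = E"
  proof
    show "Span F Us \<subseteq> E"
    proof (rule Span_min[OF F])
      show "subgroup E (add_monoid R)" using E by (rule subalgebra.axioms)
      show "F <#> set Us \<subseteq> E" using subalgebra.smult_closed[OF E] Us by (auto simp: set_mult_def)
    qed (use sub Us in auto)
    show "E \<subseteq> Span F Us" using Span_base_incl[OF F] Us sub by auto
  qed
  then have "finite_dimension F E" using Span_finite_dimension[OF F] Us sub by metis
  then show ?thesis using finite_dimensionE[OF F] by (simp add: over_def)
qed

text \<open>Below, dimensions are read off from cardinalities through this equation.\<close>

lemma (in ring) card_finite_subalgebra: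
  assumes F: "subfield F R" and E: "subalgebra F E R" and fin: "finite (carrier R)"
  shows "card E = card F ^ dim F E"
proof (rule card_dimension[OF F finite_subalgebra_dimension[OF F E]])
  show "finite F" using finite_subset[OF subfieldE(3)[OF F] fin] .
  show "finite E" using finite_subset[OF subalgebra_in_carrier[OF E] fin] .
qed

lemma card_uniform_fibres:
  assumes "finite A" and "\<And>x. x \<in> A \<Longrightarrow> card {y \<in> A. f y = f x} = c"
  shows "card A = c * card (f ` A)"
proof -
  have "card A = (\<Sum>y\<in>f ` A. card {x \<in> A. f x = y})"
    using sum.image_gen[OF assms(1), of "\<lambda>_. 1::nat" f] by simp
  also have "\<dots> = (\<Sum>y\<in>f ` A. c)"
    using assms(2) by (intro sum.cong) auto
  finally show ?thesis by simp
qed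

section \<open>Powers of an algebraic element\<close>

text \<open>The minimal polynomial generates the ideal of polynomials vanishing at \<open>x\<close>,
  which contains \<open>p\<close>; irreducibility makes the two associates.\<close>

lemma (in domain) degree_Irr:
  assumes K: "subfield K R" and x: "x \<in> carrier R"
    and p: "p \<in> carrier (K[X])" "pirreducible K p" "eval p x = \<zero>"
  shows "(algebraic over K) x" "degree (Irr K x) = degree p"
proof -
  show alg: "(algebraic over K) x"
    using pirreducibleE(1)[OF subfieldE(1)[OF K] p(1,2)] p
    by (intro algebraicI[of p]) (auto simp: univ_poly_zero)
  have "p \<in> PIdl\<^bsub>K[X]\<^esub> (Irr K x)"
    using p Irr_generates_ker[OF K x alg] unfolding a_kernel_def' by blast
  then have "Irr K x \<sim>\<^bsub>K[X]\<^esub> p"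
    using cgenideal_pirreducible[OF K IrrE(1,2)[OF K x alg] p(2)] by blast
  then show "degree (Irr K x) = degree p"
    using associated_polynomials_imp_same_length[OF subfieldE(1)[OF K] IrrE(1)[OF K x alg] p(1)]
    by simp
qed

text \<open>\<open>exp_base\<close> lists the powers in descending order, hence the reversed list of
  coefficients.\<close>

lemma (in ring) combine_exp_base:
  assumes x: "x \<in> carrier R" and c: "\<And>i. i < m \<Longrightarrow> c i \<in> carrier R"
  shows "combine (map c (rev [0..<m])) (exp_base x m) = (\<Oplus>i\<in>{..<m}. c i \<otimes> x [^] i)"
  using c
proof (induction m)
  case (Suc m)
  then have "combine (map c (rev [0..<Suc m])) (exp_base x (Suc m))
      = c m \<otimes> x [^] m \<oplus> (\<Oplus>i\<in>{..<m}. c i \<otimes> x [^] i)"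
    by (simp add: exp_base_def)
  also have "\<dots> = (\<Oplus>i\<in>{..<Suc m}. c i \<otimes> x [^] i)"
    using Suc.prems x by (simp add: lessThan_Suc finsum_insert Pi_def)
  finally show ?case .
qed (simp add: exp_base_def)

lemma (in domain) powers_independent:
  assumes K: "subfield K R" and x: "x \<in> carrier R"
    and p: "p \<in> carrier (K[X])" "pirreducible K p" "eval p x = \<zero>"
    and c: "\<And>i. i < degree p \<Longrightarrow> c i \<in> K"
    and sum: "(\<Oplus>i\<in>{..<degree p}. c i \<otimes> x [^] i) = \<zero>"
    and i: "i < degree p"
  shows "c i = \<zero>"
proof -
  let ?Ks = "map c (rev [0..<degree p])"
  have ind: "independent K (exp_base x (degree p))"
    using exp_base_independent[OF K x] degree_Irr[OF K x p] by metis
  have "set ?Ks \<subseteq> K" using c by auto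
  moreover have "combine ?Ks (exp_base x (degree p)) = \<zero>"
    using combine_exp_base[OF x, of "degree p" c] c subfieldE(3)[OF K] sum by auto
  ultimately have "set (take (length (exp_base x (degree p))) ?Ks) \<subseteq> {\<zero>}"
    using independent_imp_trivial_combine[OF K ind] by blast
  moreover have "c i \<in> set ?Ks" using i by auto
  ultimately show ?thesis by (auto simp: exp_base_def)
qed

section \<open>Shared vectors of two codewords\<close>

lemma (in ring) subfield_inv_closed: "subfield S R \<Longrightarrow> x \<in> S \<Longrightarrow> x \<noteq> \<zero> \<Longrightarrow> inv x \<in> S"
  using subfield_m_inv(1)[of S x] by simp

lemma (in field) inv_mult_cancel: "x \<in> carrier R \<Longrightarrow> x \<noteq> \<zero> \<Longrightarrow> inv x \<otimes> x = \<one>"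
  "x \<in> carrier R \<Longrightarrow> x \<noteq> \<zero> \<Longrightarrow> x \<otimes> inv x = \<one>"
  "x \<in> carrier R \<Longrightarrow> x \<noteq> \<zero> \<Longrightarrow> inv x \<in> carrier R"
  by (simp_all add: field_Units)

lemma (in domain) mult_nonzero: "x \<in> carrier R \<Longrightarrow> y \<in> carrier R \<Longrightarrow> x \<noteq> \<zero> \<Longrightarrow> y \<noteq> \<zero> \<Longrightarrow> x \<otimes> y \<noteq> \<zero>"
  using integral_iff by blast

lemma (in domain) pow_nonzero: "x \<in> carrier R \<Longrightarrow> x \<noteq> \<zero> \<Longrightarrow> x [^] (j::nat) \<noteq> \<zero>"
  by (induction j) (auto simp: integral_iff)

text \<open>To be read with \<open>x\<close> and \<open>y\<close> as powers of \<gamma>: the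
  right-hand side is sorted by 1, \<open>x\<close>, \<open>y\<close> and
  \<open>x \<otimes> y\<close>, ready for comparing coefficients.\<close>

lemma (in cring) expand_cross_product:
  assumes "u1 \<in> carrier R" "u2 \<in> carrier R" "v1 \<in> carrier R" "v2 \<in> carrier R"
    "f1 \<in> carrier R" "f2 \<in> carrier R" "g1 \<in> carrier R" "g2 \<in> carrier R"
    "x \<in> carrier R" "y \<in> carrier R"
  shows "(u1 \<oplus> f1 \<otimes> x) \<otimes> (v2 \<oplus> g2 \<otimes> y) \<ominus> (u2 \<oplus> f2 \<otimes> x) \<otimes> (v1 \<oplus> g1 \<otimes> y)
    = (u1 \<otimes> v2 \<ominus> u2 \<otimes> v1) \<oplus> (f1 \<otimes> v2 \<ominus> f2 \<otimes> v1) \<otimes> x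
      \<oplus> (u1 \<otimes> g2 \<ominus> u2 \<otimes> g1) \<otimes> y \<oplus> (f1 \<otimes> g2 \<ominus> f2 \<otimes> g1) \<otimes> (x \<otimes> y)"
  using assms by algebra

text \<open>Here \<open>s1\<close>, \<open>s2\<close>, \<open>t\<close> stand for the
  \<open>q\<close>-th powers of \<open>u1\<close>, \<open>u2\<close>, \<open>z\<close>. Once
  \<open>v1 = z \<otimes> u1\<close> and \<open>v2 = z \<otimes> u2\<close>, the last three
  coefficients of the cross product are multiples of the single determinant
  \<open>s1 \<otimes> u2 \<ominus> s2 \<otimes> u1\<close>.\<close>

lemma (in cring) cross_identities:
  assumes "u1 \<in> carrier R" "u2 \<in> carrier R" "s1 \<in> carrier R" "s2 \<in> carrier R"
    "a \<in> carrier R" "b \<in> carrier R" "c \<in> carrier R" "d \<in> carrier R" "z \<in> carrier R" "t \<in> carrier R"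
  shows "(a \<otimes> u1 \<oplus> b \<otimes> s1) \<otimes> (z \<otimes> u2) \<ominus> (a \<otimes> u2 \<oplus> b \<otimes> s2) \<otimes> (z \<otimes> u1)
      = (b \<otimes> z) \<otimes> (s1 \<otimes> u2 \<ominus> s2 \<otimes> u1)"
    and "u1 \<otimes> (c \<otimes> (z \<otimes> u2) \<oplus> d \<otimes> (t \<otimes> s2)) \<ominus> u2 \<otimes> (c \<otimes> (z \<otimes> u1) \<oplus> d \<otimes> (t \<otimes> s1))
      = \<ominus> ((d \<otimes> t) \<otimes> (s1 \<otimes> u2 \<ominus> s2 \<otimes> u1))"
    and "(a \<otimes> u1 \<oplus> b \<otimes> s1) \<otimes> (c \<otimes> (z \<otimes> u2) \<oplus> d \<otimes> (t \<otimes> s2))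
        \<ominus> (a \<otimes> u2 \<oplus> b \<otimes> s2) \<otimes> (c \<otimes> (z \<otimes> u1) \<oplus> d \<otimes> (t \<otimes> s1))
      = (c \<otimes> (b \<otimes> z) \<ominus> a \<otimes> (d \<otimes> t)) \<otimes> (s1 \<otimes> u2 \<ominus> s2 \<otimes> u1)"
  using assms by algebra+

section \<open>The setting, the parametrising map \<open>w\<close> and pairs of shared
  vectors\<close>

locale orbit_code = field R for R (structure) +
  fixes q k n r e :: nat and \<xi> \<gamma> :: 'a and G :: "'a set"
  assumes fin: "finite (carrier R)"
    and q_pp: "prime_power_nat q"
    and card_R: "card (carrier R) = q ^ n"
    and k2: "k \<ge> 2" and r2: "r > 2" and n_def: "n = r * k"
    and e_def: "e = nat \<lceil>real r / 2\<rceil> - 1"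
    and xi_in: "\<xi> \<in> subfield_of_order R (q ^ k)"
    and xi_prim: "subfield_of_order R (q ^ k) - {\<zero>} = {\<xi> [^] i | i :: nat. True}"
    and G_sub: "G \<subseteq> subfield_of_order R (q ^ k) - {\<zero>}"
    and G_rep: "\<forall>x \<in> subfield_of_order R (q ^ k) - {\<zero>}.
                  \<exists>!t. t \<in> G \<and> x \<otimes> inv t \<in> {(\<xi> [^] (q - 1)) [^] i | i :: nat. True}"
    and gamma_in: "\<gamma> \<in> carrier R"
    and gamma_root: "\<exists>p. polynomial (subfield_of_order R (q ^ k)) p
                          \<and> pirreducible (subfield_of_order R (q ^ k)) p
                          \<and> degree p = r \<and> eval p \<gamma> = \<zero>"
begin

abbreviation "F \<equiv> subfield_of_order R q"
abbreviation "K \<equiv> subfield_of_order R (q ^ k)"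

definition w :: "'a \<Rightarrow> 'a \<Rightarrow> nat \<Rightarrow> 'a \<Rightarrow> 'a" where
  "w a b l u = u \<oplus> (a \<otimes> u \<oplus> b \<otimes> u [^] q) \<otimes> \<gamma> [^] l"

definition codeword :: "'a \<Rightarrow> 'a \<Rightarrow> 'a \<Rightarrow> nat \<Rightarrow> 'a set" where
  "codeword \<alpha> a b l = (\<lambda>u. \<alpha> \<otimes> w a b l u) ` K"

lemma q_ge_2: "q \<ge> 2"
proof -
  obtain p m where p: "Factorial_Ring.prime p" "m > 0" "q = p ^ m"
    using q_pp unfolding prime_power_nat_def by blast
  have "p ^ m \<ge> p" using p prime_ge_1_nat by (intro self_le_power) auto
  then show ?thesis using p prime_ge_2_nat[OF p(1)] by simp
qed

lemma qk_ge_2: "q ^ k \<ge> 2"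
  using self_le_power[of q k] q_ge_2 k2 by linarith

text \<open>\<open>q ^ j\<close> is a power of the characteristic, so this is an iterated Frobenius
  map.\<close>

lemma pow_add:
  assumes "x \<in> carrier R" "y \<in> carrier R"
  shows "(x \<oplus> y) [^] (q ^ j) = x [^] (q ^ j) \<oplus> y [^] (q ^ j)"
proof -
  obtain p m where p: "Factorial_Ring.prime p" "m > 0" "q = p ^ m"
    using q_pp unfolding prime_power_nat_def by blast
  have "card (carrier R) = p ^ (m * n)" using card_R p by (simp add: power_mult)
  then have "[p] \<cdot> \<one> = \<zero>" by (rule finite_domain_char)
  from frobenius_power_add[OF p(1) this assms, of "m * j"] show ?thesis
    using p by (simp add: power_mult)
qed

lemma pow_q_add:
  assumes "x \<in> carrier R" "y \<in> carrier R"
  shows "(x \<oplus> y) [^] q = x [^] q \<oplus> y [^] q"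
  using pow_add[OF assms, of 1] by simp

lemma F_subfield: "subfield F R" and K_subfield: "subfield K R"
proof -
  show "subfield F R" using q_ge_2 pow_q_add by (intro subfield_of_order_is_subfield) auto
  show "subfield K R" using q_ge_2 pow_add by (intro subfield_of_order_is_subfield) auto
qed

lemma card_F: "card F = q" and card_K: "card K = q ^ k"
proof -
  have "n > 0" using n_def r2 k2 by simp
  then show "card F = q" "card K = q ^ k"
    using card_subfield_of_order[OF fin card_R q_ge_2, of 1]
      card_subfield_of_order[OF fin card_R q_ge_2, of k] k2 n_def by auto
qed

lemma finite_K: "finite K" and finite_F: "finite F"
  using fin by (auto simp: subfield_of_order_def)

lemma K_carrier: "x \<in> K \<Longrightarrow> x \<in> carrier R" and F_carrier: "x \<in> F \<Longrightarrow> x \<in> carrier R"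
  by (auto simp: subfield_of_order_def)

lemma F_sub_K: "x \<in> F \<Longrightarrow> x \<in> K"
proof -
  assume x: "x \<in> F"
  have "x [^] (q ^ j) = x" for j
    by (induction j) (use x in \<open>auto simp: subfield_of_order_def simp flip: nat_pow_pow\<close>)
  then show "x \<in> K" using x by (simp add: subfield_of_order_def)
qed

lemmas K_zero = subringE(2)[OF subfieldE(1)[OF K_subfield]]
lemmas K_one = subringE(3)[OF subfieldE(1)[OF K_subfield]]
lemmas K_uminus = subringE(5)[OF subfieldE(1)[OF K_subfield]]
lemmas K_mult = subringE(6)[OF subfieldE(1)[OF K_subfield]]
lemmas K_add = subringE(7)[OF subfieldE(1)[OF K_subfield]]

lemma K_minus: "x \<in> K \<Longrightarrow> y \<in> K \<Longrightarrow> x \<ominus> y \<in> K"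
  by (simp add: a_minus_def K_add K_uminus)

lemma K_pow: "x \<in> K \<Longrightarrow> x [^] (j::nat) \<in> K"
  by (induction j) (simp_all add: K_one K_mult)

lemma K_inv: "x \<in> K \<Longrightarrow> x \<noteq> \<zero> \<Longrightarrow> inv x \<in> K"
  by (rule subfield_inv_closed[OF K_subfield])

text \<open>\<open>e\<close> is the largest integer with \<open>2 * e < r\<close>; this keeps every
  exponent in a cross product below the degree of \<gamma>.\<close>

lemma two_e_less_r: "l \<in> {1..e} \<Longrightarrow> m \<in> {1..e} \<Longrightarrow> l + m < r"
proof -
  assume "l \<in> {1..e}" "m \<in> {1..e}"
  moreover have "2 * e < r" unfolding e_def using r2 by linarith
  ultimately show ?thesis by auto
qed

lemma e_pos: "e \<ge> 1"
  unfolding e_def using r2 by linarith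

text \<open>The exponents 0, \<open>l\<close>, \<open>m\<close>, \<open>l + m\<close> are below
  \<open>r\<close> and distinct, except that \<open>l\<close> and \<open>m\<close> may coincide;
  then only the sum of their coefficients is determined.\<close>

lemma gamma_powers_independent:
  assumes "A \<in> K" "B \<in> K" "C \<in> K" "D \<in> K" and lm: "l \<ge> 1" "m \<ge> 1" "l + m < r"
    and eq: "A \<oplus> B \<otimes> \<gamma> [^] l \<oplus> C \<otimes> \<gamma> [^] m \<oplus> D \<otimes> (\<gamma> [^] l \<otimes> \<gamma> [^] m) = \<zero>"
  shows "A = \<zero>" "D = \<zero>" "l \<noteq> m \<Longrightarrow> B = \<zero>" "l \<noteq> m \<Longrightarrow> C = \<zero>" "l = m \<Longrightarrow> B \<oplus> C = \<zero>"
proof -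
  obtain p where p: "p \<in> carrier (K[X])" "pirreducible K p" "degree p = r" "eval p \<gamma> = \<zero>"
    using gamma_root by (auto simp: univ_poly_def)
  note carr = assms(1-4)[THEN K_carrier]
  \<comment> \<open>\<open>s j Z\<close> is the coefficient sequence of the monomial with
    coefficient \<open>Z\<close> and exponent \<open>j\<close>. Adding four of them treats
    \<open>l = m\<close> and \<open>l \<noteq> m\<close> uniformly.\<close>
  define s where "s j Z i = (if i = j then Z else \<zero>)" for j i :: nat and Z
  define c where "c i = s 0 A i \<oplus> s l B i \<oplus> s m C i \<oplus> s (l + m) D i" for i
  have sc: "s j Z i \<in> carrier R" if "Z \<in> carrier R" for j Z i
    using that by (simp add: s_def)
  have ss: "(\<Oplus>i\<in>{..<r}. s j Z i \<otimes> \<gamma> [^] i) = Z \<otimes> \<gamma> [^] j"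
    if "j < r" "Z \<in> carrier R" for j Z
  proof -
    have "(\<Oplus>i\<in>{..<r}. s j Z i \<otimes> \<gamma> [^] i) = (\<Oplus>i\<in>{..<r}. if j = i then Z \<otimes> \<gamma> [^] i else \<zero>)"
      using that gamma_in by (intro finsum_cong') (auto simp: s_def)
    also have "\<dots> = Z \<otimes> \<gamma> [^] j"
      using that gamma_in by (intro add.finprod_singleton) auto
    finally show ?thesis .
  qed
  have "(\<Oplus>i\<in>{..<r}. c i \<otimes> \<gamma> [^] i) =
      (\<Oplus>i\<in>{..<r}. s 0 A i \<otimes> \<gamma> [^] i \<oplus> s l B i \<otimes> \<gamma> [^] i \<oplus> s m C i \<otimes> \<gamma> [^] i
         \<oplus> s (l + m) D i \<otimes> \<gamma> [^] i)"
    using gamma_in carr sc by (intro finsum_cong') (auto simp: c_def l_distr)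
  also have "\<dots> = A \<otimes> \<gamma> [^] (0::nat) \<oplus> B \<otimes> \<gamma> [^] l \<oplus> C \<otimes> \<gamma> [^] m \<oplus> D \<otimes> \<gamma> [^] (l + m)"
    using gamma_in carr sc lm by (simp add: finsum_addf ss Pi_def del: nat_pow_0)
  also have "\<dots> = \<zero>"
    using eq gamma_in carr by (simp add: nat_pow_mult)
  finally have sum: "(\<Oplus>i\<in>{..<r}. c i \<otimes> \<gamma> [^] i) = \<zero>" .
  have "c i \<in> K" for i
    using assms(1-4) by (simp add: c_def s_def K_zero K_add)
  then have c0: "c i = \<zero>" if "i < r" for i
    using powers_independent[OF K_subfield gamma_in p(1,2,4), of c i] sum that p(3) by simp
  show "A = \<zero>" using c0[of 0] lm carr by (simp add: c_def s_def)
  show "D = \<zero>" using c0[of "l + m"] lm carr by (simp add: c_def s_def)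
  show "B = \<zero>" if "l \<noteq> m" using that c0[of l] lm carr by (simp add: c_def s_def)
  show "C = \<zero>" if "l \<noteq> m" using that c0[of m] lm carr by (simp add: c_def s_def)
  show "B \<oplus> C = \<zero>" if "l = m" using that c0[of m] lm carr by (simp add: c_def s_def)
qed

lemma w_closed: "a \<in> K \<Longrightarrow> b \<in> K \<Longrightarrow> u \<in> K \<Longrightarrow> w a b l u \<in> carrier R"
  using gamma_in by (simp add: w_def K_carrier)

lemma w_add:
  assumes "a \<in> K" "b \<in> K" "u \<in> K" "v \<in> K"
  shows "w a b l (u \<oplus> v) = w a b l u \<oplus> w a b l v"
proof -
  have *: "u \<oplus> v \<oplus> (a \<otimes> (u \<oplus> v) \<oplus> b \<otimes> (s \<oplus> t)) \<otimes> g
      = u \<oplus> (a \<otimes> u \<oplus> b \<otimes> s) \<otimes> g \<oplus> (v \<oplus> (a \<otimes> v \<oplus> b \<otimes> t) \<otimes> g)"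
    if "s \<in> carrier R" "t \<in> carrier R" "g \<in> carrier R" for s t g
    using that assms[THEN K_carrier] by algebra
  show ?thesis
    using *[of "u [^] q" "v [^] q" "\<gamma> [^] l"] gamma_in assms by (simp add: w_def K_carrier pow_q_add)
qed

lemma w_smult:
  assumes "a \<in> K" "b \<in> K" "u \<in> K" "c \<in> F"
  shows "w a b l (c \<otimes> u) = c \<otimes> w a b l u"
proof -
  have *: "c \<otimes> u \<oplus> (a \<otimes> (c \<otimes> u) \<oplus> b \<otimes> (c \<otimes> s)) \<otimes> g = c \<otimes> (u \<oplus> (a \<otimes> u \<oplus> b \<otimes> s) \<otimes> g)"
    if "s \<in> carrier R" "g \<in> carrier R" for s g
    using that assms(1-3)[THEN K_carrier] F_carrier[OF assms(4)] by algebra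
  have "(c \<otimes> u) [^] q = c \<otimes> u [^] q"
    using assms by (simp add: nat_pow_distrib K_carrier F_carrier) (simp add: subfield_of_order_def)
  then show ?thesis
    using *[of "u [^] q" "\<gamma> [^] l"] gamma_in assms by (simp add: w_def K_carrier)
qed

lemma w_eq_zero:
  assumes "a \<in> K" "b \<in> K" "u \<in> K" "l \<in> {1..e}" "w a b l u = \<zero>"
  shows "u = \<zero>"
proof (rule gamma_powers_independent(1))
  \<comment> \<open>The relation is padded with zero terms at \<open>m = l\<close>, so that
    \<open>u\<close> is its constant coefficient.\<close>
  show "u \<oplus> (a \<otimes> u \<oplus> b \<otimes> u [^] q) \<otimes> \<gamma> [^] l \<oplus> \<zero> \<otimes> \<gamma> [^] l \<oplus> \<zero> \<otimes> (\<gamma> [^] l \<otimes> \<gamma> [^] l) = \<zero>"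
    using assms gamma_in by (simp add: w_def K_carrier)
qed (use assms two_e_less_r[of l l] in \<open>auto intro: K_add K_mult K_zero K_pow\<close>)

lemma w_zero: "a \<in> K \<Longrightarrow> b \<in> K \<Longrightarrow> w a b l \<zero> = \<zero>"
  using q_ge_2 gamma_in by (simp add: w_def K_carrier nat_pow_zero)

lemma w_inj:
  assumes "a \<in> K" "b \<in> K" "l \<in> {1..e}" 
  shows "inj_on (w a b l) K"
proof (rule inj_onI)
  fix u v assume uv: "u \<in> K" "v \<in> K" "w a b l u = w a b l v"
  have m: "\<ominus> v \<in> K" using uv by (simp add: K_uminus)
  have "w a b l (u \<oplus> \<ominus> v) = w a b l (v \<oplus> \<ominus> v)"
    using w_add assms uv m by simp
  then have "w a b l (u \<oplus> \<ominus> v) = \<zero>" using uv assms by (simp add: r_neg K_carrier w_zero)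
  then have "u \<oplus> \<ominus> v = \<zero>" using w_eq_zero assms uv m K_add by blast
  then show "u = v" using uv by (metis K_carrier a_minus_def r_right_minus_eq)
qed

text \<open>The hypothesis says that the ratio \<open>u2 \<otimes> inv u1\<close> is fixed by the
  \<open>q\<close>-th power map.\<close>

lemma proportional_if_pow_cross:
  assumes u: "u1 \<in> K" "u2 \<in> K" "u1 \<noteq> \<zero>" and eq: "u1 [^] q \<otimes> u2 = u2 [^] q \<otimes> u1"
  shows "\<exists>c\<in>F. u2 = c \<otimes> u1"
proof (intro bexI)
  let ?c = "u2 \<otimes> inv u1"
  have c: "u1 \<in> carrier R" "u2 \<in> carrier R" "inv u1 \<in> carrier R" using u by (auto simp: K_carrier inv_mult_cancel)
  show u2: "u2 = ?c \<otimes> u1" using c u by (simp add: m_assoc inv_mult_cancel)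
  \<comment> \<open>Both sides are the two sides of \<open>eq\<close> with \<open>u2\<close> written
    as \<open>?c \<otimes> u1\<close>.\<close>
  have "u1 [^] q \<otimes> u1 \<otimes> ?c [^] q = u1 [^] q \<otimes> u1 \<otimes> ?c"
  proof -
    have "u2 [^] q = ?c [^] q \<otimes> u1 [^] q" 
      using c u2 by (metis m_closed nat_pow_distrib)
    then show ?thesis using eq u2 c by (metis m_assoc m_closed m_comm nat_pow_closed)
  qed
  then have "?c [^] q = ?c"
    using c u m_lcancel[of "u1 [^] q \<otimes> u1" "?c [^] q" ?c] by (simp add: mult_nonzero pow_nonzero)
  then show "?c \<in> F" using c by (simp add: subfield_of_order_def)
qed

text \<open>The constant coefficient of the cross relation gives one scalar \<open>z\<close> with
  \<open>v1 = z \<otimes> u1\<close> and \<open>v2 = z \<otimes> u2\<close>. The other coefficients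
  are then multiples of a nonzero determinant. For \<open>l \<noteq> m\<close> they force
  \<open>b = d = \<zero>\<close>; for \<open>l = m\<close> the two middle ones combine to
  \<open>b \<otimes> z = d \<otimes> z [^] q\<close>, and the last one then gives
  \<open>a = c\<close> unless \<open>b = \<zero>\<close>.\<close>

lemma shared_pair_parameters:
  assumes abcd: "a \<in> K" "b \<in> K" "c \<in> K" "d \<in> K" and lm: "l \<in> {1..e}" "m \<in> {1..e}"
    and uv: "u1 \<in> K" "u2 \<in> K" "v1 \<in> K" "v2 \<in> K" and nz: "u1 \<noteq> \<zero>" "v1 \<noteq> \<zero>"
    and indep: "\<And>x. x \<in> F \<Longrightarrow> u2 \<noteq> x \<otimes> u1"
    and eq: "w a b l u1 \<otimes> w c d m v2 = w a b l u2 \<otimes> w c d m v1"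
  shows "b = \<zero> \<and> d = \<zero> \<or>
    b \<noteq> \<zero> \<and> l = m \<and> a = c \<and> (\<exists>z\<in>K - {\<zero>}. v1 = z \<otimes> u1 \<and> b \<otimes> z = d \<otimes> z [^] q)"
proof -
  note carr = abcd[THEN K_carrier] uv[THEN K_carrier]
  let ?f1 = "a \<otimes> u1 \<oplus> b \<otimes> u1 [^] q" and ?f2 = "a \<otimes> u2 \<oplus> b \<otimes> u2 [^] q"
  let ?g1 = "c \<otimes> v1 \<oplus> d \<otimes> v1 [^] q" and ?g2 = "c \<otimes> v2 \<oplus> d \<otimes> v2 [^] q"
  have fg: "?f1 \<in> K" "?f2 \<in> K" "?g1 \<in> K" "?g2 \<in> K"
    using abcd uv by (auto intro!: K_mult K_add K_pow)
  have "(u1 \<otimes> v2 \<ominus> u2 \<otimes> v1) \<oplus> (?f1 \<otimes> v2 \<ominus> ?f2 \<otimes> v1) \<otimes> \<gamma> [^] l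
      \<oplus> (u1 \<otimes> ?g2 \<ominus> u2 \<otimes> ?g1) \<otimes> \<gamma> [^] m \<oplus> (?f1 \<otimes> ?g2 \<ominus> ?f2 \<otimes> ?g1) \<otimes> (\<gamma> [^] l \<otimes> \<gamma> [^] m)
    = w a b l u1 \<otimes> w c d m v2 \<ominus> w a b l u2 \<otimes> w c d m v1"
    unfolding w_def using fg gamma_in carr
    by (intro expand_cross_product[symmetric]) (auto simp: K_carrier)
  also have "\<dots> = \<zero>" unfolding eq using abcd uv by (simp add: w_closed)
  finally have sum: "(u1 \<otimes> v2 \<ominus> u2 \<otimes> v1) \<oplus> (?f1 \<otimes> v2 \<ominus> ?f2 \<otimes> v1) \<otimes> \<gamma> [^] l
      \<oplus> (u1 \<otimes> ?g2 \<ominus> u2 \<otimes> ?g1) \<otimes> \<gamma> [^] m \<oplus> (?f1 \<otimes> ?g2 \<ominus> ?f2 \<otimes> ?g1) \<otimes> (\<gamma> [^] l \<otimes> \<gamma> [^] m) = \<zero>" .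
  have inK: "u1 \<otimes> v2 \<ominus> u2 \<otimes> v1 \<in> K" "?f1 \<otimes> v2 \<ominus> ?f2 \<otimes> v1 \<in> K"
     "u1 \<otimes> ?g2 \<ominus> u2 \<otimes> ?g1 \<in> K" "?f1 \<otimes> ?g2 \<ominus> ?f2 \<otimes> ?g1 \<in> K"
    using fg uv by (auto intro!: K_minus K_mult)
  have lm': "l \<ge> 1" "m \<ge> 1" "l + m < r" using lm two_e_less_r by auto
  note co = gamma_powers_independent[OF inK lm' sum]
  define z where "z = v1 \<otimes> inv u1"
  have zK: "z \<in> K" using uv nz by (simp add: z_def K_inv K_mult)
  then have zc: "z \<in> carrier R" by (rule K_carrier)
  have iu: "inv u1 \<in> carrier R" using carr nz by (simp add: inv_mult_cancel)
  have v1: "v1 = z \<otimes> u1" using carr nz iu by (simp add: z_def m_assoc inv_mult_cancel)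
  have z0: "z \<noteq> \<zero>" using v1 nz carr by auto
  \<comment> \<open>\<open>z\<close> was defined from the first pair only; the vanishing constant
    coefficient carries it over to the second.\<close>
  have "u1 \<otimes> v2 = u1 \<otimes> (z \<otimes> u2)"
  proof -
    have "u1 \<otimes> v2 = u2 \<otimes> v1" using co(1) carr by simp
    then show ?thesis using v1 carr zc by (simp add: m_ac)
  qed
  then have v2: "v2 = z \<otimes> u2" using carr nz zc by (simp add: m_lcancel)
  have v1q: "v1 [^] q = z [^] q \<otimes> u1 [^] q" and v2q: "v2 [^] q = z [^] q \<otimes> u2 [^] q"
    using v1 v2 carr zc by (simp_all add: nat_pow_distrib)
  let ?D = "u1 [^] q \<otimes> u2 \<ominus> u2 [^] q \<otimes> u1"
  \<comment> \<open>A vanishing determinant would make \<open>u2\<close> an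
    \<open>F\<close>-multiple of \<open>u1\<close>.\<close>
  have D: "?D \<in> carrier R" "?D \<noteq> \<zero>"
    using proportional_if_pow_cross[of u1 u2] uv nz indep carr by auto
  note ids = cross_identities[of u1 u2 "u1 [^] q" "u2 [^] q" a b c d z "z [^] q"]
  have B: "?f1 \<otimes> v2 \<ominus> ?f2 \<otimes> v1 = (b \<otimes> z) \<otimes> ?D"
    unfolding v1 v2 using carr zc by (intro ids(1)) auto
  have C: "u1 \<otimes> ?g2 \<ominus> u2 \<otimes> ?g1 = \<ominus> ((d \<otimes> z [^] q) \<otimes> ?D)"
    unfolding v1q v2q unfolding v1 v2 using carr zc by (intro ids(2)) auto
  have E: "?f1 \<otimes> ?g2 \<ominus> ?f2 \<otimes> ?g1 = (c \<otimes> (b \<otimes> z) \<ominus> a \<otimes> (d \<otimes> z [^] q)) \<otimes> ?D"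
    unfolding v1q v2q unfolding v1 v2 using carr zc by (intro ids(3)) auto
  have zq0: "z [^] q \<noteq> \<zero>" using z0 zc by (rule pow_nonzero[rotated])
  show ?thesis
  proof (cases "l = m")
    case False
    have "(b \<otimes> z) \<otimes> ?D = \<zero>" using co(3)[OF False] B by simp
    then have "b = \<zero>" using D carr zc z0 by (simp add: integral_iff)
    moreover have "\<ominus> ((d \<otimes> z [^] q) \<otimes> ?D) = \<zero>" using co(4)[OF False] C by simp
    then have "(d \<otimes> z [^] q) \<otimes> ?D = \<zero>"
      using D carr zc by (metis m_closed nat_pow_closed minus_minus minus_zero)
    then have "d = \<zero>" using D carr zc zq0 by (simp add: integral_iff)
    ultimately show ?thesis by simp
  next
    case True
    have "(b \<otimes> z) \<otimes> ?D \<oplus> \<ominus> ((d \<otimes> z [^] q) \<otimes> ?D) = \<zero>"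
      using co(5)[OF True] B C by simp
    then have "(b \<otimes> z) \<otimes> ?D = (d \<otimes> z [^] q) \<otimes> ?D"
      using D carr zc by (metis a_minus_def m_closed nat_pow_closed r_right_minus_eq)
    then have bd: "b \<otimes> z = d \<otimes> z [^] q"
      using D carr zc by (simp add: m_rcancel)
    have "(c \<otimes> (b \<otimes> z) \<ominus> a \<otimes> (d \<otimes> z [^] q)) \<otimes> ?D = \<zero>" using co(2) E by simp
    then have "c \<otimes> (b \<otimes> z) \<ominus> a \<otimes> (b \<otimes> z) = \<zero>" using D carr zc bd by (simp add: integral_iff)
    then have ca: "c \<otimes> (b \<otimes> z) = a \<otimes> (b \<otimes> z)" using carr zc by simp
    show ?thesis
    proof (cases "b = \<zero>")
      case True
      then have "d \<otimes> z [^] q = \<zero>" using bd zc by simp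
      then show ?thesis using True carr zc zq0 by (simp add: integral_iff)
    next
      case False
      then have "b \<otimes> z \<noteq> \<zero>" using carr zc z0 by (simp add: integral_iff)
      then have "a = c" using ca carr zc by (simp add: m_rcancel)
      then show ?thesis using False \<open>l = m\<close> v1 z0 zK bd by auto
    qed
  qed
qed

section \<open>Codewords as subspaces over \<open>F\<close> and their intersections\<close>

lemma F_minus_one: "\<ominus> \<one> \<in> F"
  using subringE(3,5)[OF subfieldE(1)[OF F_subfield]] by simp

lemma codeword_memI: "u \<in> K \<Longrightarrow> \<alpha> \<otimes> w a b l u \<in> codeword \<alpha> a b l"
  by (simp add: codeword_def)

lemma codeword_smult:
  assumes "a \<in> K" "b \<in> K" "\<alpha> \<in> carrier R" "c \<in> F" "x \<in> codeword \<alpha> a b l"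
  shows "c \<otimes> x \<in> codeword \<alpha> a b l"
proof -
  obtain u where u: "u \<in> K" "x = \<alpha> \<otimes> w a b l u" using assms(5) by (auto simp: codeword_def)
  have "c \<otimes> x = \<alpha> \<otimes> w a b l (c \<otimes> u)"
    using assms u by (simp add: w_smult w_closed F_carrier m_lcomm)
  then show ?thesis using codeword_memI[of "c \<otimes> u"] u assms by (simp add: K_mult F_sub_K)
qed

lemma codeword_subalgebra:
  assumes ab: "a \<in> K" "b \<in> K" and \<alpha>: "\<alpha> \<in> carrier R"
  shows "subalgebra F (codeword \<alpha> a b l) R"
proof (intro subalgebra.intro add.subgroupI)
  show sub: "codeword \<alpha> a b l \<subseteq> carrier R"
    using assms by (auto simp: codeword_def w_closed)
  show "codeword \<alpha> a b l \<noteq> {}"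
    using K_zero by (auto simp: codeword_def)
  show "\<ominus> x \<in> codeword \<alpha> a b l" if "x \<in> codeword \<alpha> a b l" for x
  proof -
    have "x \<in> carrier R" using that sub by blast
    then have "\<ominus> x = \<ominus> \<one> \<otimes> x" by (simp add: l_minus)
    then show ?thesis using codeword_smult[OF ab \<alpha> F_minus_one that] by simp
  qed
  show "x \<oplus> y \<in> codeword \<alpha> a b l" if xy: "x \<in> codeword \<alpha> a b l" "y \<in> codeword \<alpha> a b l" for x y
  proof -
    obtain u v where uv: "u \<in> K" "v \<in> K" "x = \<alpha> \<otimes> w a b l u" "y = \<alpha> \<otimes> w a b l v"
      using xy by (auto simp: codeword_def)
    have "x \<oplus> y = \<alpha> \<otimes> w a b l (u \<oplus> v)"
      using assms uv by (simp add: w_add w_closed r_distr)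
    then show ?thesis using codeword_memI[of "u \<oplus> v"] uv by (simp add: K_add)
  qed
  show "subalgebra_axioms F (codeword \<alpha> a b l) R"
    using codeword_smult[OF ab \<alpha>] by (simp add: subalgebra_axioms_def)
qed

lemma card_eq_pow_dim: "subalgebra F E R \<Longrightarrow> card E = q ^ dim F E"
  using card_finite_subalgebra[OF F_subfield _ fin] card_F by simp

text \<open>The parametrisation by \<open>K\<close> is injective, so the codeword has
  \<open>q ^ k\<close> elements.\<close>

lemma dim_codeword:
  assumes "a \<in> K" "b \<in> K" "\<alpha> \<in> carrier R - {\<zero>}" "l \<in> {1..e}"
  shows "dim F (codeword \<alpha> a b l) = k"
proof -
  have "inj_on (\<lambda>u. \<alpha> \<otimes> w a b l u) K"
  proof (rule inj_onI)
    fix u v assume uv: "u \<in> K" "v \<in> K" "\<alpha> \<otimes> w a b l u = \<alpha> \<otimes> w a b l v"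
    then have "w a b l u = w a b l v" using assms by (simp add: m_lcancel w_closed)
    then show "u = v" using inj_onD[OF w_inj] assms uv by blast
  qed
  then have "card (codeword \<alpha> a b l) = q ^ k"
    by (simp add: codeword_def card_image card_K)
  moreover have "card (codeword \<alpha> a b l) = q ^ dim F (codeword \<alpha> a b l)"
    using assms by (intro card_eq_pow_dim codeword_subalgebra) auto
  ultimately show ?thesis using q_ge_2 power_inject_exp[of q] by auto
qed

text \<open>By counting: \<open>E\<close> has more than \<open>q\<close> elements, while a nonzero
  \<open>x1\<close> has at most \<open>q\<close> multiples by \<open>F\<close>.\<close>

lemma independent_pair:
  assumes E: "subalgebra F E R" and d: "dim F E \<ge> 2"
  obtains x1 x2 where "x1 \<in> E" "x2 \<in> E" "x1 \<noteq> \<zero>" "\<And>c. c \<in> F \<Longrightarrow> x2 \<noteq> c \<otimes> x1"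
proof -
  have "q ^ 1 < q ^ dim F E" using q_ge_2 d by (intro power_strict_increasing) auto
  then have big: "card E > q" using card_eq_pow_dim[OF E] by simp
  have finE: "finite E" using finite_subset[OF subalgebra_in_carrier[OF E] fin] .
  have "\<not> E \<subseteq> {\<zero>}" using card_mono[of "{\<zero>}" E] big q_ge_2 by auto
  then obtain x1 where x1: "x1 \<in> E" "x1 \<noteq> \<zero>" by blast
  have "\<not> E \<subseteq> (\<lambda>c. c \<otimes> x1) ` F"
  proof
    assume "E \<subseteq> (\<lambda>c. c \<otimes> x1) ` F"
    then have "card E \<le> card ((\<lambda>c. c \<otimes> x1) ` F)" using finite_F by (intro card_mono) auto
    also have "\<dots> \<le> q" using card_image_le[OF finite_F] card_F by metis
    finally show False using big by simp
  qed
  then obtain x2 where "x2 \<in> E" "x2 \<notin> (\<lambda>c. c \<otimes> x1) ` F" by blast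
  then show thesis using that[OF x1(1) _ x1(2)] by blast
qed

text \<open>Two independent shared vectors are expressed in both codewords, and cross-multiplication
  removes \<alpha> and \<beta>. The last clause recovers the relation between the shifts in the case
  where the two codewords will turn out to be equal.\<close>

lemma codewords_meeting:
  assumes abcd: "a \<in> K" "b \<in> K" "c \<in> K" "d \<in> K" and lm: "l \<in> {1..e}" "m \<in> {1..e}"
    and \<alpha>: "\<alpha> \<in> carrier R - {\<zero>}" and \<beta>: "\<beta> \<in> carrier R - {\<zero>}"
    and meet: "dim F (codeword \<alpha> a b l \<inter> codeword \<beta> c d m) \<ge> 2"
  shows "b = \<zero> \<and> d = \<zero> \<or>
    b \<noteq> \<zero> \<and> l = m \<and> a = c \<and>
      (\<exists>z\<in>K - {\<zero>}. b \<otimes> z = d \<otimes> z [^] q \<and> (b = d \<longrightarrow> z \<in> F \<longrightarrow> \<alpha> = \<beta> \<otimes> z))"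
proof -
  have "subalgebra F (codeword \<alpha> a b l \<inter> codeword \<beta> c d m) R"
    using assms by (intro subalgebra_inter codeword_subalgebra) auto
  then obtain x1 x2 where x: "x1 \<in> codeword \<alpha> a b l" "x1 \<in> codeword \<beta> c d m"
      "x2 \<in> codeword \<alpha> a b l" "x2 \<in> codeword \<beta> c d m" "x1 \<noteq> \<zero>"
      and ind: "\<And>c. c \<in> F \<Longrightarrow> x2 \<noteq> c \<otimes> x1"
    using independent_pair[OF _ meet] by (metis IntD1 IntD2)
  obtain u1 u2 v1 v2 where uv: "u1 \<in> K" "u2 \<in> K" "v1 \<in> K" "v2 \<in> K"
    and eqs: "x1 = \<alpha> \<otimes> w a b l u1" "x2 = \<alpha> \<otimes> w a b l u2"
      "x1 = \<beta> \<otimes> w c d m v1" "x2 = \<beta> \<otimes> w c d m v2"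
    using x by (auto simp: codeword_def)
  have wc: "w a b l u1 \<in> carrier R" "w a b l u2 \<in> carrier R"
    "w c d m v1 \<in> carrier R" "w c d m v2 \<in> carrier R"
    using abcd uv by (auto simp: w_closed)
  have ab: "\<alpha> \<in> carrier R" "\<beta> \<in> carrier R" using \<alpha> \<beta> by auto
  have u1: "u1 \<noteq> \<zero>" using x(5) eqs(1) abcd ab by (auto simp: w_zero)
  have v1: "v1 \<noteq> \<zero>" using x(5) eqs(3) abcd ab by (auto simp: w_zero)
  have indu: "u2 \<noteq> y \<otimes> u1" if "y \<in> F" for y
  proof
    assume "u2 = y \<otimes> u1"
    then have "x2 = y \<otimes> x1" unfolding eqs(1,2)
      using abcd uv that wc ab by (simp add: w_smult m_lcomm F_carrier)
    then show False using ind that by blast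
  qed
  \<comment> \<open>The product \<open>x1 \<otimes> x2\<close> is written with \<open>x1\<close>
    from the first codeword and \<open>x2\<close> from the second, then the other way round; both
    carry the factor \<open>\<alpha> \<otimes> \<beta>\<close>.\<close>
  have "(\<alpha> \<otimes> \<beta>) \<otimes> (w a b l u1 \<otimes> w c d m v2) = x1 \<otimes> x2"
    unfolding eqs(1,4) using wc ab by (simp add: m_ac)
  also have "x1 \<otimes> x2 = (\<alpha> \<otimes> \<beta>) \<otimes> (w a b l u2 \<otimes> w c d m v1)"
    unfolding eqs(2,3) using wc ab by (simp add: m_ac)
  finally have cross: "w a b l u1 \<otimes> w c d m v2 = w a b l u2 \<otimes> w c d m v1"
    using wc ab \<alpha> \<beta> by (subst (asm) m_lcancel) (auto simp: mult_nonzero)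
  have "b = \<zero> \<and> d = \<zero> \<or>
    b \<noteq> \<zero> \<and> l = m \<and> a = c \<and> (\<exists>z\<in>K - {\<zero>}. v1 = z \<otimes> u1 \<and> b \<otimes> z = d \<otimes> z [^] q)"
    by (rule shared_pair_parameters[OF abcd lm uv u1 v1 _ cross]) (rule indu)
  then show ?thesis
  proof (elim disjE conjE bexE)
    fix z assume z: "b \<noteq> \<zero>" "l = m" "a = c" "z \<in> K - {\<zero>}" "v1 = z \<otimes> u1" "b \<otimes> z = d \<otimes> z [^] q"
    have "\<alpha> = \<beta> \<otimes> z" if bd: "b = d" and zF: "z \<in> F"
    proof -
      \<comment> \<open>For \<open>z\<close> in \<open>F\<close> the map \<open>w\<close> is
        homogeneous, so the two expressions for \<open>x1\<close> differ only in their scalar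
        factors.\<close>
      have "w c d m v1 = z \<otimes> w a b l u1" using z bd zF abcd uv by (simp add: w_smult)
      then have "\<alpha> \<otimes> w a b l u1 = (\<beta> \<otimes> z) \<otimes> w a b l u1"
        using eqs(1,3) wc ab F_carrier[OF zF] by (simp add: m_assoc)
      moreover have "w a b l u1 \<noteq> \<zero>" using w_eq_zero abcd uv lm u1 by blast
      ultimately show ?thesis using wc ab F_carrier[OF zF] by (simp add: m_rcancel)
    qed
    then show ?thesis using z by blast
  qed simp
qed

section \<open>Coset representatives modulo (q - 1)-th powers\<close>

text \<open>Since \<xi> generates the units of \<open>K\<close>, the powers of
  \<open>\<xi> [^] (q - 1)\<close> are all the (q - 1)-th powers.\<close>

lemma xi_powers: "{(\<xi> [^] (q - 1)) [^] i | i :: nat. True} = (\<lambda>z. z [^] (q - 1)) ` (K - {\<zero>})"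
proof -
  have "(\<xi> [^] (q - 1)) [^] i = (\<xi> [^] i) [^] (q - 1)" for i :: nat
    using K_carrier[OF xi_in] by (simp add: nat_pow_pow mult.commute)
  then show ?thesis unfolding xi_prim by auto
qed

lemma pow_q: "z \<in> carrier R \<Longrightarrow> z [^] q = z [^] (q - 1) \<otimes> z"
proof -
  have "q = Suc (q - 1)" using q_ge_2 by simp
  then show ?thesis by (metis nat_pow_Suc)
qed

lemma G_memD: assumes "g \<in> G" shows "g \<in> K" "g \<in> carrier R" "g \<noteq> \<zero>"
  using assms G_sub K_carrier by auto

text \<open>Both \<open>g\<close> and \<open>h\<close> represent the coset of the common
  value.\<close>

lemma G_unique:
  assumes g: "g \<in> G" and h: "h \<in> G" and y: "y \<in> K - {\<zero>}" and z: "z \<in> K - {\<zero>}"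
    and eq: "g \<otimes> y [^] (q - 1) = h \<otimes> z [^] (q - 1)"
  shows "g = h"
proof -
  let ?x = "g \<otimes> y [^] (q - 1)"
  have c: "y \<in> carrier R" "z \<in> carrier R" using y z K_carrier by auto
  have x: "?x \<in> K - {\<zero>}"
    using G_memD[OF g] y c by (simp add: K_mult K_pow mult_nonzero pow_nonzero)
  have xg: "(t \<otimes> s) \<otimes> inv t = s" if "t \<in> G" "s \<in> carrier R" for t s
  proof -
    have t: "t \<in> carrier R" "t \<noteq> \<zero>" "inv t \<in> carrier R"
      using G_memD[OF that(1)] by (simp_all add: inv_mult_cancel)
    then have "(t \<otimes> s) \<otimes> inv t = s \<otimes> (t \<otimes> inv t)" using that(2) by (simp add: m_ac)
    then show ?thesis using t that(2) by (simp add: inv_mult_cancel)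
  qed
  have "?x \<otimes> inv g \<in> (\<lambda>z. z [^] (q - 1)) ` (K - {\<zero>})"
    using xg[OF g] c y by simp
  moreover have "?x \<otimes> inv h \<in> (\<lambda>z. z [^] (q - 1)) ` (K - {\<zero>})"
    unfolding eq using xg[OF h] c z by simp
  ultimately show ?thesis using G_rep[rule_format, OF x] g h unfolding xi_powers by blast
qed

text \<open>Dividing by \<open>z\<close> gives \<open>g = h \<otimes> z [^] (q - 1)\<close>, so
  \<open>g\<close> and \<open>h\<close> lie in one coset and agree; cancelling them leaves
  \<open>z [^] q = z\<close>.\<close>

lemma G_twist:
  assumes g: "g \<in> G" and h: "h \<in> G" and z: "z \<in> K - {\<zero>}"
    and eq: "g \<otimes> z = h \<otimes> z [^] q"
  shows "g = h" "z \<in> F"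
proof -
  have c: "z \<in> carrier R" "z \<noteq> \<zero>" using z K_carrier by auto
  have "g \<otimes> z = (h \<otimes> z [^] (q - 1)) \<otimes> z"
    using eq c G_memD[OF h] by (simp add: pow_q m_assoc)
  then have "g = h \<otimes> z [^] (q - 1)" using c G_memD[OF g] G_memD[OF h] by (simp add: m_rcancel)
  then have "g \<otimes> \<one> [^] (q - 1) = h \<otimes> z [^] (q - 1)" using G_memD[OF g] by simp
  from G_unique[OF g h _ z this] show "g = h" using K_one by simp
  then have "z [^] q = z" using eq c G_memD[OF h] by (simp add: m_lcancel)
  then show "z \<in> F" using c by (simp add: subfield_of_order_def)
qed

lemma card_F_units: "card (F - {\<zero>}) = q - 1" and card_K_units: "card (K - {\<zero>}) = q ^ k - 1"
  using card_F card_K finite_F finite_K K_zero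
    subringE(2)[OF subfieldE(1)[OF F_subfield]] by (simp_all add: card_Diff_singleton)

lemma card_R_units: "card (carrier R - {\<zero>}) = q ^ n - 1"
  using card_R fin by (simp add: card_Diff_singleton)

lemma finite_G: "finite G"
  using G_sub finite_K by (meson finite_Diff finite_subset)

text \<open>Every unit of \<open>K\<close> is a representative times a (q - 1)-th power. The map
  \<open>?f\<close> is therefore onto the \<open>q ^ k - 1\<close> units, and its fibres have size
  \<open>q - 1\<close>.\<close>

lemma card_G: "card G = q - 1"
proof -
  let ?A = "G \<times> (K - {\<zero>})"
  let ?f = "\<lambda>(g, z). g \<otimes> z [^] (q - 1)"
  have img: "?f ` ?A = K - {\<zero>}"
  proof (intro subset_antisym subsetI)
    fix x assume "x \<in> ?f ` ?A"
    then show "x \<in> K - {\<zero>}"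
      using G_memD by (auto simp: K_mult K_pow mult_nonzero pow_nonzero K_carrier)
  next
    fix x assume x: "x \<in> K - {\<zero>}"
    then obtain t where t: "t \<in> G" "x \<otimes> inv t \<in> (\<lambda>z. z [^] (q - 1)) ` (K - {\<zero>})"
      using G_rep unfolding xi_powers by blast
    then obtain z where z: "z \<in> K - {\<zero>}" "x \<otimes> inv t = z [^] (q - 1)" by blast
    have tc: "t \<in> carrier R" "t \<noteq> \<zero>" "inv t \<in> carrier R" "x \<in> carrier R"
      using G_memD[OF t(1)] x by (auto simp: inv_mult_cancel K_carrier)
    then have "t \<otimes> (x \<otimes> inv t) = x \<otimes> (t \<otimes> inv t)" by (simp add: m_ac)
    then have "t \<otimes> (x \<otimes> inv t) = x" using tc by (simp add: inv_mult_cancel)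
    then have "x = ?f (t, z)" using z by simp
    then show "x \<in> ?f ` ?A" using t(1) z(1) by blast
  qed
  have "card ?A = (q - 1) * card (?f ` ?A)"
  proof (rule card_uniform_fibres)
    show "finite ?A" using finite_G finite_K by simp
    fix x assume "x \<in> ?A"
    then obtain g z where x: "x = (g, z)" "g \<in> G" "z \<in> K - {\<zero>}" by blast
    have zc: "z \<in> carrier R" "z \<noteq> \<zero>" using x K_carrier by auto
    \<comment> \<open>The representative is unique, and \<open>z\<close> is determined up to the
      kernel of the (q - 1)-th power map, which is \<open>F - {\<zero>}\<close>.\<close>
    have "{y \<in> ?A. ?f y = ?f x} = (\<lambda>c. (g, c \<otimes> z)) ` (F - {\<zero>})"
    proof (intro subset_antisym subsetI)
      fix y assume "y \<in> {y \<in> ?A. ?f y = ?f x}"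
      then obtain h s where y: "y = (h, s)" "h \<in> G" "s \<in> K - {\<zero>}"
        and eq: "h \<otimes> s [^] (q - 1) = g \<otimes> z [^] (q - 1)" using x(1) by auto
      have hg: "h = g" by (rule G_unique[OF y(2) x(2) y(3) x(3) eq])
      have sc: "s \<in> carrier R" "s \<noteq> \<zero>" using y K_carrier by auto
      have "s [^] (q - 1) = z [^] (q - 1)"
        using eq hg G_memD[OF x(2)] sc zc by (simp add: m_lcancel)
      then have "z [^] q \<otimes> s = s [^] q \<otimes> z"
        using sc zc by (simp add: pow_q m_ac)
      then obtain c where c: "c \<in> F" "s = c \<otimes> z"
        using proportional_if_pow_cross[of z s] x(3) y(3) by auto
      have "c \<noteq> \<zero>" using c sc zc by auto
      then show "y \<in> (\<lambda>c. (g, c \<otimes> z)) ` (F - {\<zero>})" using y hg c by auto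
    next
      fix y assume "y \<in> (\<lambda>c. (g, c \<otimes> z)) ` (F - {\<zero>})"
      then obtain c where c: "c \<in> F - {\<zero>}" "y = (g, c \<otimes> z)" by blast
      have cc: "c \<in> carrier R" "c \<noteq> \<zero>" "c [^] q = c" using c by (auto simp: subfield_of_order_def)
      have "c [^] (q - 1) \<otimes> c = \<one> \<otimes> c" using pow_q[of c] cc by simp
      then have "c [^] (q - 1) = \<one>" using cc by (subst (asm) m_rcancel) auto
      then have "(c \<otimes> z) [^] (q - 1) = z [^] (q - 1)"
        using cc zc by (simp add: nat_pow_distrib)
      moreover have "c \<otimes> z \<in> K - {\<zero>}"
        using c x zc cc by (simp add: K_mult F_sub_K mult_nonzero)
      ultimately show "y \<in> {y \<in> ?A. ?f y = ?f x}" using x c by simp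
    qed
    moreover have "inj_on (\<lambda>c. (g, c \<otimes> z)) (F - {\<zero>})"
      using zc by (auto simp: inj_on_def m_rcancel F_carrier)
    ultimately show "card {y \<in> ?A. ?f y = ?f x} = q - 1"
      by (simp add: card_image card_F_units)
  qed
  then have "card G * (q ^ k - 1) = (q - 1) * (q ^ k - 1)"
    unfolding img by (simp add: card_cartesian_product card_K_units)
  moreover have "q ^ k - 1 > 0" using qk_ge_2 by simp
  ultimately show ?thesis by simp
qed

section \<open>The code\<close>

text \<open>Taking \<open>b = g a\<close> for \<open>a \<noteq> 0\<close> and \<open>b = g\<close> for \<open>a = 0\<close> treats the families \<open>U\<close> and \<open>V\<close> at once,
  with \<open>a\<close> ranging over all of \<open>K\<close>.\<close>
definition twist :: "'a \<Rightarrow> 'a \<Rightarrow> 'a" where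
  "twist a g = (if a = \<zero> then g else g \<otimes> a)"

definition index :: "('a \<times> 'a \<times> nat \<times> 'a) set" where
  "index = K \<times> G \<times> {1..e} \<times> (carrier R - {\<zero>})"

definition twisted :: "'a \<times> 'a \<times> nat \<times> 'a \<Rightarrow> 'a set" where
  "twisted = (\<lambda>(a, g, l, \<alpha>). codeword \<alpha> a (twist a g) l)"

text \<open>The exponent 1 is a placeholder from \<open>{1..e}\<close>: with both coefficients zero
  the power of \<gamma> does not matter, and these are the shifts of \<open>K\<close>.\<close>

definition straight :: "'a \<Rightarrow> 'a set" where
  "straight \<alpha> = codeword \<alpha> \<zero> \<zero> 1"

definition code :: "'a set set" where
  "code = twisted ` index \<union> straight ` (carrier R - {\<zero>})"

lemma twist_closed: "a \<in> K \<Longrightarrow> g \<in> G \<Longrightarrow> twist a g \<in> K \<and> twist a g \<noteq> \<zero>"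
  using G_memD[of g] by (auto simp: twist_def K_mult mult_nonzero K_carrier)

lemma codeword_scale_subset:
  assumes "a \<in> K" "b \<in> K" "\<alpha> \<in> carrier R" "z \<in> F"
  shows "codeword (\<alpha> \<otimes> z) a b l \<subseteq> codeword \<alpha> a b l"
proof
  fix x assume "x \<in> codeword (\<alpha> \<otimes> z) a b l"
  then obtain u where u: "u \<in> K" "x = (\<alpha> \<otimes> z) \<otimes> w a b l u" by (auto simp: codeword_def)
  then have "x = \<alpha> \<otimes> w a b l (z \<otimes> u)"
    using assms by (simp add: w_smult w_closed F_carrier m_assoc)
  then show "x \<in> codeword \<alpha> a b l" using codeword_memI[of "z \<otimes> u"] u assms by (simp add: K_mult F_sub_K)
qed

text \<open>A factor from \<open>F\<close> is absorbed into the parameter \<open>u\<close>; the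
  reverse inclusion comes from scaling by \<open>inv z\<close>.\<close>

lemma codeword_scale:
  assumes "a \<in> K" "b \<in> K" "\<alpha> \<in> carrier R" "z \<in> F - {\<zero>}"
  shows "codeword (\<alpha> \<otimes> z) a b l = codeword \<alpha> a b l"
proof
  have z: "z \<in> carrier R" "z \<noteq> \<zero>" "inv z \<in> F"
    using assms subfield_inv_closed[OF F_subfield] F_carrier by auto
  show "codeword (\<alpha> \<otimes> z) a b l \<subseteq> codeword \<alpha> a b l"
    using assms codeword_scale_subset by simp
  have "codeword ((\<alpha> \<otimes> z) \<otimes> inv z) a b l \<subseteq> codeword (\<alpha> \<otimes> z) a b l"
    using assms z by (intro codeword_scale_subset) auto
  then show "codeword \<alpha> a b l \<subseteq> codeword (\<alpha> \<otimes> z) a b l"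
    using assms z by (simp add: m_assoc inv_mult_cancel)
qed

text \<open>Since \<open>twist a g\<close> is nonzero, the alternative with both coefficients zero
  is excluded; what remains is an equation to which \<open>G_twist\<close> applies.\<close>

lemma twisted_meeting:
  assumes i: "(a, g, l, \<alpha>) \<in> index" and j: "(c, h, m, \<beta>) \<in> index"
    and meet: "dim F (twisted (a, g, l, \<alpha>) \<inter> twisted (c, h, m, \<beta>)) \<ge> 2"
  shows "a = c \<and> g = h \<and> l = m \<and> (\<exists>z\<in>F - {\<zero>}. \<alpha> = \<beta> \<otimes> z)"
proof -
  have i': "a \<in> K" "g \<in> G" "l \<in> {1..e}" "\<alpha> \<in> carrier R - {\<zero>}" using i by (auto simp: index_def)
  have j': "c \<in> K" "h \<in> G" "m \<in> {1..e}" "\<beta> \<in> carrier R - {\<zero>}" using j by (auto simp: index_def)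
  have meet': "dim F (codeword \<alpha> a (twist a g) l \<inter> codeword \<beta> c (twist c h) m) \<ge> 2"
    using meet by (simp add: twisted_def)
  have t: "twist a g \<in> K" "twist a g \<noteq> \<zero>" "twist c h \<in> K"
    using twist_closed i' j' by auto
  from codewords_meeting[OF i'(1) t(1) j'(1) t(3) i'(3) j'(3) i'(4) j'(4) meet'] t(2)
  obtain z where eqs: "l = m" "a = c" and z: "z \<in> K - {\<zero>}" "twist a g \<otimes> z = twist c h \<otimes> z [^] q"
    and \<alpha>: "twist a g = twist c h \<longrightarrow> z \<in> F \<longrightarrow> \<alpha> = \<beta> \<otimes> z" by blast
  have zc: "z \<in> carrier R" using z K_carrier by auto
  \<comment> \<open>As \<open>a = c\<close>, both twists contain the same factor \<open>a\<close> or
    none, and it cancels.\<close>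
  have "g \<otimes> z = h \<otimes> z [^] q"
  proof (cases "a = \<zero>")
    case True
    then show ?thesis using z eqs by (simp add: twist_def)
  next
    case False
    have carr: "g \<in> carrier R" "h \<in> carrier R" "a \<in> carrier R"
      using i' j' G_memD K_carrier by auto
    have "a \<otimes> (g \<otimes> z) = a \<otimes> (h \<otimes> z [^] q)"
      using z(2) eqs False zc carr by (simp add: twist_def m_ac)
    then show ?thesis using False zc carr by (simp add: m_lcancel)
  qed
  from G_twist[OF i'(2) j'(2) z(1) this] show ?thesis using eqs \<alpha> z by auto
qed

text \<open>A larger intersection would give \<open>b \<otimes> z = \<zero>\<close> with
  \<open>b\<close> and \<open>z\<close> both nonzero.\<close>

lemma twisted_straight_meeting:
  assumes i: "i \<in> index" and \<beta>: "\<beta> \<in> carrier R - {\<zero>}"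
  shows "dim F (twisted i \<inter> straight \<beta>) \<le> 1"
proof (rule ccontr)
  obtain a g l \<alpha> where ieq: "i = (a, g, l, \<alpha>)" by (cases i)
  have i': "a \<in> K" "g \<in> G" "l \<in> {1..e}" "\<alpha> \<in> carrier R - {\<zero>}" using i ieq by (auto simp: index_def)
  have t: "twist a g \<in> K" "twist a g \<noteq> \<zero>" using twist_closed i' by auto
  have one: "1 \<in> {1..e}" using e_pos by simp
  assume "\<not> dim F (twisted i \<inter> straight \<beta>) \<le> 1"
  then have "dim F (codeword \<alpha> a (twist a g) l \<inter> codeword \<beta> \<zero> \<zero> 1) \<ge> 2"
    by (simp add: ieq twisted_def straight_def)
  from codewords_meeting[OF i'(1) t(1) K_zero K_zero i'(3) one i'(4) \<beta> this] t(2)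
  obtain z where "z \<in> K - {\<zero>}" "twist a g \<otimes> z = \<zero> \<otimes> z [^] q" by blast
  then show False using t by (auto simp: K_carrier integral_iff)
qed

lemma straight_eq: "\<alpha> \<in> carrier R \<Longrightarrow> straight \<alpha> = (\<lambda>u. \<alpha> \<otimes> u) ` K"
  using gamma_in by (auto simp: straight_def codeword_def w_def K_carrier image_iff)

text \<open>If \<open>x = \<alpha> \<otimes> u = \<beta> \<otimes> v\<close>, the scalar is
  \<open>v \<otimes> inv u\<close>: as \<open>K\<close> is a field, one common nonzero vector
  suffices.\<close>

lemma straight_meeting:
  assumes \<alpha>: "\<alpha> \<in> carrier R - {\<zero>}" and \<beta>: "\<beta> \<in> carrier R - {\<zero>}"
    and x: "x \<in> straight \<alpha>" "x \<in> straight \<beta>" "x \<noteq> \<zero>"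
  shows "\<exists>z\<in>K - {\<zero>}. \<alpha> = \<beta> \<otimes> z"
proof -
  have ab: "\<alpha> \<in> carrier R" "\<beta> \<in> carrier R" using \<alpha> \<beta> by auto
  obtain u v where uv: "u \<in> K" "v \<in> K" "x = \<alpha> \<otimes> u" "x = \<beta> \<otimes> v"
    using x ab by (auto simp: straight_eq)
  have nz: "u \<noteq> \<zero>" "v \<noteq> \<zero>" using uv x ab by auto
  have c: "u \<in> carrier R" "v \<in> carrier R" "inv u \<in> carrier R" using uv nz K_carrier K_inv by auto
  have "\<alpha> = (\<alpha> \<otimes> u) \<otimes> inv u" using c ab nz by (simp add: m_assoc inv_mult_cancel)
  also have "\<dots> = (\<beta> \<otimes> v) \<otimes> inv u" using uv(3,4) by simp
  also have "\<dots> = \<beta> \<otimes> (v \<otimes> inv u)" using c ab by (simp add: m_assoc)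
  finally have eq: "\<alpha> = \<beta> \<otimes> (v \<otimes> inv u)" .
  moreover have "v \<otimes> inv u \<in> K" using uv nz by (simp add: K_mult K_inv)
  moreover have "v \<otimes> inv u \<noteq> \<zero>" using eq \<alpha> ab by auto
  ultimately show ?thesis by blast
qed

lemma straight_scale_subset:
  assumes "\<alpha> \<in> carrier R" "z \<in> K"
  shows "straight (\<alpha> \<otimes> z) \<subseteq> straight \<alpha>"
  using assms by (auto simp: straight_eq K_carrier m_assoc K_mult)

text \<open>Here all units of \<open>K\<close> are absorbed, not only those of \<open>F\<close>;
  this is why the orbit of \<open>K\<close> is shorter than the others.\<close>

lemma straight_scale:
  assumes "\<alpha> \<in> carrier R" "z \<in> K - {\<zero>}"
  shows "straight (\<alpha> \<otimes> z) = straight \<alpha>"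
proof
  have z: "z \<in> carrier R" "z \<noteq> \<zero>" "inv z \<in> K" using assms K_inv K_carrier by auto
  show "straight (\<alpha> \<otimes> z) \<subseteq> straight \<alpha>" using assms straight_scale_subset by simp
  have "straight ((\<alpha> \<otimes> z) \<otimes> inv z) \<subseteq> straight (\<alpha> \<otimes> z)"
    using assms z by (intro straight_scale_subset) auto
  then show "straight \<alpha> \<subseteq> straight (\<alpha> \<otimes> z)"
    using assms z by (simp add: m_assoc inv_mult_cancel)
qed

lemma code_subalgebra:
  assumes "A \<in> code" shows "subalgebra F A R" "dim F A = k"
proof -
  obtain \<alpha> a b l where "A = codeword \<alpha> a b l" "a \<in> K" "b \<in> K" "\<alpha> \<in> carrier R - {\<zero>}" "l \<in> {1..e}"
  proof -
    show thesis using assms unfolding code_def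
    proof
      assume "A \<in> twisted ` index"
      then obtain a g l \<alpha> where "(a, g, l, \<alpha>) \<in> index" "A = twisted (a, g, l, \<alpha>)" by auto
      then show thesis using that[of \<alpha> a "twist a g" l] twist_closed
        by (auto simp: index_def twisted_def)
    next
      assume "A \<in> straight ` (carrier R - {\<zero>})"
      then show thesis using that[of _ \<zero> \<zero> 1] K_zero e_pos by (auto simp: straight_def)
    qed
  qed
  then show "subalgebra F A R" "dim F A = k" using codeword_subalgebra dim_codeword by auto
qed

lemma code_meeting:
  assumes A: "A \<in> code" and B: "B \<in> code" and ne: "A \<noteq> B"
  shows "dim F (A \<inter> B) \<le> 1"
proof (rule ccontr)
  assume "\<not> dim F (A \<inter> B) \<le> 1"
  then have d: "dim F (A \<inter> B) \<ge> 2" by simp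
  have "A \<in> twisted ` index \<union> straight ` (carrier R - {\<zero>})"
    "B \<in> twisted ` index \<union> straight ` (carrier R - {\<zero>})"
    using A B by (simp_all only: code_def)
  then show False
  proof (elim UnE imageE)
    fix i j assume *: "A = twisted i" "i \<in> index" "B = twisted j" "j \<in> index"
    obtain a g l \<alpha> where i: "i = (a, g, l, \<alpha>)" by (cases i)
    obtain c h m \<beta> where j: "j = (c, h, m, \<beta>)" by (cases j)
    have "a = c \<and> g = h \<and> l = m \<and> (\<exists>z\<in>F - {\<zero>}. \<alpha> = \<beta> \<otimes> z)"
      using * d by (intro twisted_meeting) (simp_all add: i j)
    then obtain z where z: "a = c" "g = h" "l = m" "z \<in> F - {\<zero>}" "\<alpha> = \<beta> \<otimes> z" by blast
    have "c \<in> K" "h \<in> G" "\<beta> \<in> carrier R" using *(4) by (simp_all add: j index_def)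
    then have "codeword (\<beta> \<otimes> z) c (twist c h) m = codeword \<beta> c (twist c h) m"
      using z(4) twist_closed[of c h] by (intro codeword_scale) simp_all
    then show False using ne * z by (simp add: i j twisted_def)
  next
    fix i \<beta> assume "A = twisted i" "i \<in> index" "B = straight \<beta>" "\<beta> \<in> carrier R - {\<zero>}"
    then show False using d twisted_straight_meeting[of i \<beta>] by simp
  next
    fix i \<beta> assume "A = straight \<beta>" "\<beta> \<in> carrier R - {\<zero>}" "B = twisted i" "i \<in> index"
    then show False using d twisted_straight_meeting[of i \<beta>] by (simp add: Int_commute)
  next
    fix \<alpha> \<beta> assume *: "A = straight \<alpha>" "\<alpha> \<in> carrier R - {\<zero>}" "B = straight \<beta>" "\<beta> \<in> carrier R - {\<zero>}"
    have "subalgebra F (A \<inter> B) R" using A B code_subalgebra(1) subalgebra_inter by blast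
    from independent_pair[OF this d] obtain x where x: "x \<in> A \<inter> B" "x \<noteq> \<zero>" by metis
    have "\<exists>z\<in>K - {\<zero>}. \<alpha> = \<beta> \<otimes> z"
      using * x by (intro straight_meeting[of _ _ x]) simp_all
    then obtain z where "z \<in> K - {\<zero>}" "\<alpha> = \<beta> \<otimes> z" by blast
    then show False using ne * straight_scale[of \<beta> z] by simp
  qed
qed

section \<open>Counting the codewords\<close>

text \<open>Parameters are determined up to scaling \<alpha> by a unit of \<open>F\<close>, so the
  parametrisation is \<open>q - 1\<close> to one, and this cancels the factor
  \<open>card G\<close>.\<close>

lemma card_twisted: "card (twisted ` index) = e * q ^ k * (q ^ n - 1)"
proof -
  have "card index = (q - 1) * card (twisted ` index)"
  proof (rule card_uniform_fibres)
    show "finite index" using finite_K finite_G fin by (simp add: index_def)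
    fix x assume x: "x \<in> index"
    obtain a g l \<alpha> where xeq: "x = (a, g, l, \<alpha>)" by (cases x)
    have x': "a \<in> K" "g \<in> G" "l \<in> {1..e}" "\<alpha> \<in> carrier R" "\<alpha> \<noteq> \<zero>" using x xeq by (auto simp: index_def)
    have "{y \<in> index. twisted y = twisted x} = (\<lambda>z. (a, g, l, \<alpha> \<otimes> z)) ` (F - {\<zero>})"
    proof (intro subset_antisym subsetI)
      fix y assume y: "y \<in> {y \<in> index. twisted y = twisted x}"
      obtain c h m \<beta> where yeq: "y = (c, h, m, \<beta>)" by (cases y)
      have "dim F (twisted x) = k" using x by (intro code_subalgebra) (auto simp: code_def)
      \<comment> \<open>Equal codewords meet in dimension \<open>k\<close>, so the intersection
        result also describes the fibres.\<close>
      then have "dim F (twisted y \<inter> twisted x) \<ge> 2" using y k2 by simp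
      then show "y \<in> (\<lambda>z. (a, g, l, \<alpha> \<otimes> z)) ` (F - {\<zero>})"
        using twisted_meeting[of c h m \<beta> a g l \<alpha>] x y xeq yeq by auto
    next
      fix y assume "y \<in> (\<lambda>z. (a, g, l, \<alpha> \<otimes> z)) ` (F - {\<zero>})"
      then obtain z where z: "z \<in> F - {\<zero>}" "y = (a, g, l, \<alpha> \<otimes> z)" by blast
      then show "y \<in> {y \<in> index. twisted y = twisted x}"
        using x' xeq codeword_scale[of a "twist a g" \<alpha> z l] twist_closed[of a g]
        by (auto simp: index_def twisted_def F_carrier integral_iff)
    qed
    moreover have "inj_on (\<lambda>z. (a, g, l, \<alpha> \<otimes> z)) (F - {\<zero>})"
      using x' by (auto simp: inj_on_def m_lcancel F_carrier)
    ultimately show "card {y \<in> index. twisted y = twisted x} = q - 1"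
      by (simp add: card_image card_F_units)
  qed
  moreover have "card index = (q - 1) * (e * q ^ k * (q ^ n - 1))"
    by (simp add: index_def card_cartesian_product card_K card_G card_R_units)
  moreover have "q - 1 > 0" using q_ge_2 by simp
  ultimately show ?thesis by (metis mult_left_cancel neq0_conv)
qed

text \<open>Two shifts of \<open>K\<close> agree exactly when the factors differ by a unit of
  \<open>K\<close>. The product form avoids division of naturals.\<close>

lemma card_straight: "q ^ n - 1 = (q ^ k - 1) * card (straight ` (carrier R - {\<zero>}))"
proof -
  have "card (carrier R - {\<zero>}) = (q ^ k - 1) * card (straight ` (carrier R - {\<zero>}))"
  proof (rule card_uniform_fibres)
    fix \<alpha> assume \<alpha>: "\<alpha> \<in> carrier R - {\<zero>}"
    have "{\<beta> \<in> carrier R - {\<zero>}. straight \<beta> = straight \<alpha>} = (\<lambda>z. \<alpha> \<otimes> z) ` (K - {\<zero>})"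
    proof (intro subset_antisym subsetI)
      fix \<beta> assume \<beta>: "\<beta> \<in> {\<beta> \<in> carrier R - {\<zero>}. straight \<beta> = straight \<alpha>}"
      have "\<alpha> \<otimes> \<one> \<in> straight \<alpha>" using \<alpha> K_one straight_eq[of \<alpha>] by blast
      then have "\<alpha> \<in> straight \<alpha>" using \<alpha> by simp
      then show "\<beta> \<in> (\<lambda>z. \<alpha> \<otimes> z) ` (K - {\<zero>})" using straight_meeting[of \<beta> \<alpha> \<alpha>] \<alpha> \<beta> by auto
    next
      fix \<beta> assume "\<beta> \<in> (\<lambda>z. \<alpha> \<otimes> z) ` (K - {\<zero>})"
      then show "\<beta> \<in> {\<beta> \<in> carrier R - {\<zero>}. straight \<beta> = straight \<alpha>}"
        using \<alpha> straight_scale by (auto simp: K_carrier integral_iff)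
    qed
    moreover have "inj_on (\<lambda>z. \<alpha> \<otimes> z) (K - {\<zero>})"
      using \<alpha> by (auto simp: inj_on_def m_lcancel K_carrier)
    ultimately show "card {\<beta> \<in> carrier R - {\<zero>}. straight \<beta> = straight \<alpha>} = q ^ k - 1"
      by (simp add: card_image card_K_units)
  qed (use fin in simp)
  then show ?thesis by (simp add: card_R_units)
qed

lemma twisted_straight_disjoint: "twisted ` index \<inter> straight ` (carrier R - {\<zero>}) = {}"
proof (rule ccontr)
  assume "twisted ` index \<inter> straight ` (carrier R - {\<zero>}) \<noteq> {}"
  then obtain i \<beta> where i: "i \<in> index" "\<beta> \<in> carrier R - {\<zero>}" "twisted i = straight \<beta>" by blast
  then have "dim F (straight \<beta>) \<le> 1" using twisted_straight_meeting[of i \<beta>] by simp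
  moreover have "dim F (straight \<beta>) = k" using i by (intro code_subalgebra) (auto simp: code_def)
  ultimately show False using k2 by simp
qed

lemma card_code: "real (card code) = real e * real q ^ k * (real q ^ n - 1) + (real q ^ n - 1) / (real q ^ k - 1)"
proof -
  have "finite index" using finite_K finite_G fin by (simp add: index_def)
  then have "card code = card (twisted ` index) + card (straight ` (carrier R - {\<zero>}))"
    unfolding code_def using fin twisted_straight_disjoint by (intro card_Un_disjoint) auto
  then have code: "real (card code) = real e * real q ^ k * real (q ^ n - 1)
      + real (card (straight ` (carrier R - {\<zero>})))"
    by (simp add: card_twisted)
  have qs: "real (q ^ n - 1) = real q ^ n - 1" "real (q ^ k - 1) = real q ^ k - 1"
    using q_ge_2 by (auto simp: of_nat_diff)
  have "q ^ k - 1 > 0" using qk_ge_2 by linarith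
  then have "real (q ^ k - 1) \<noteq> 0" by (simp only: of_nat_eq_0_iff)
  moreover have "real (q ^ n - 1) = real (q ^ k - 1) * real (card (straight ` (carrier R - {\<zero>})))"
    unfolding of_nat_mult[symmetric] by (rule arg_cong[OF card_straight])
  ultimately have "real (card (straight ` (carrier R - {\<zero>}))) = real (q ^ n - 1) / real (q ^ k - 1)"
    by (metis nonzero_mult_div_cancel_left)
  then show ?thesis using code unfolding qs by (simp only:)
qed

section \<open>The minimum distance\<close>

text \<open>The lower bound is the bound 1 on intersections. It is attained by a codeword of type
  \<open>V\<close> and the shift of \<open>K\<close> by one of its nonzero vectors.\<close>

lemma min_dist_code: "min_dist R F code = 2 * int k - 2"
  unfolding min_dist_def
proof (rule Min_eqI)
  have sub: "code \<subseteq> Pow (carrier R)"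
    using subalgebra_in_carrier[OF code_subalgebra(1)] by auto
  then have "finite code" by (rule finite_subset) (use fin in simp)
  then have "finite ((\<lambda>(A, B). subspace_dist R F A B) ` (code \<times> code))" by simp
  then show "finite {subspace_dist R F A B |A B. A \<in> code \<and> B \<in> code \<and> A \<noteq> B}"
    by (rule finite_subset[rotated]) auto
  show "y \<ge> 2 * int k - 2"
    if y: "y \<in> {subspace_dist R F A B |A B. A \<in> code \<and> B \<in> code \<and> A \<noteq> B}" for y
  proof -
    obtain A B where *: "A \<in> code" "B \<in> code" "A \<noteq> B" "y = subspace_dist R F A B" using y by blast
    then show ?thesis
      using code_subalgebra(2)[of A] code_subalgebra(2)[of B] code_meeting[of A B]
      by (simp add: subspace_dist_def)
  qed
  have "G \<noteq> {}" using card_G q_ge_2 by auto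
  then obtain g where g: "g \<in> G" by blast
  define i where "i = (\<zero>, g, 1::nat, \<one>)"
  have i: "i \<in> index" using g K_zero e_pos by (simp add: i_def index_def)
  \<comment> \<open>\<open>x\<close> lies in \<open>twisted i\<close> as the image of
    \<open>\<one>\<close>, and in \<open>straight x\<close> as
    \<open>x \<otimes> \<one>\<close>.\<close>
  define x where "x = w \<zero> g 1 \<one>"
  have xc: "x \<in> carrier R" using G_memD[OF g] K_zero K_one by (simp add: x_def w_closed)
  have x0: "x \<noteq> \<zero>" using w_eq_zero[of \<zero> g \<one> 1] G_memD[OF g] K_zero K_one e_pos
    by (auto simp: x_def)
  have "\<one> \<otimes> x \<in> twisted i"
    unfolding i_def twisted_def x_def using codeword_memI[OF K_one] by (simp add: twist_def)
  then have xt: "x \<in> twisted i" using xc by simp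
  have "x \<otimes> \<one> \<in> straight x" using xc K_one straight_eq[of x] by blast
  then have xs: "x \<in> straight x" using xc by simp
  let ?A = "twisted i" and ?B = "straight x"
  have AB: "?A \<in> code" "?B \<in> code" using i xc x0 by (auto simp: code_def)
  have le: "dim F (?A \<inter> ?B) \<le> 1" using twisted_straight_meeting[OF i] xc x0 by simp
  have ne: "?A \<noteq> ?B" using le code_subalgebra(2)[OF AB(1)] k2 by auto
  have sa: "subalgebra F (?A \<inter> ?B) R" using AB code_subalgebra(1) subalgebra_inter by blast
  have "dim F (?A \<inter> ?B) \<noteq> 0"
  proof
    assume "dim F (?A \<inter> ?B) = 0"
    then have "card (?A \<inter> ?B) = 1" using card_eq_pow_dim[OF sa] by simp
    moreover have "\<zero> \<in> ?A \<inter> ?B"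
      using subgroup.one_closed[OF subalgebra.axioms(1)[OF sa]] by simp
    ultimately show False using xt xs x0 by (metis IntI card_1_singletonE singletonD)
  qed
  then have "dim F (?A \<inter> ?B) = 1" using le by simp
  then have "subspace_dist R F ?A ?B = 2 * int k - 2"
    using code_subalgebra(2)[OF AB(1)] code_subalgebra(2)[OF AB(2)] by (simp add: subspace_dist_def)
  then show "2 * int k - 2 \<in> {subspace_dist R F A B |A B. A \<in> code \<and> B \<in> code \<and> A \<noteq> B}"
    using AB ne by (intro CollectI exI[of _ ?A] exI[of _ ?B] conjI) simp_all
qed

section \<open>Agreement with the given families of orbits\<close>

lemma orbit_w: "orbit R (w a b l ` K) = (\<lambda>\<alpha>. codeword \<alpha> a b l) ` (carrier R - {\<zero>})"
  by (auto simp: orbit_def codeword_def image_image)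

text \<open>Expanding the product with \<delta> gives the coefficients \<open>a = \<delta>\<close>
  and \<open>b = \<tau> \<otimes> \<delta>\<close>.\<close>

lemma U_sub_eq:
  assumes "\<tau> \<in> K" "\<delta> \<in> K"
  shows "U_sub R q K \<gamma> \<tau> \<delta> l = w \<delta> (\<tau> \<otimes> \<delta>) l ` K"
proof -
  have *: "u \<oplus> (\<tau> \<otimes> s \<oplus> u) \<otimes> \<delta> \<otimes> g = u \<oplus> (\<delta> \<otimes> u \<oplus> \<tau> \<otimes> \<delta> \<otimes> s) \<otimes> g"
    if "u \<in> K" "s \<in> carrier R" "g \<in> carrier R" for u s g
    using K_carrier[OF that(1)] that(2,3) assms[THEN K_carrier] by algebra
  have "U_sub R q K \<gamma> \<tau> \<delta> l = (\<lambda>u. u \<oplus> (\<tau> \<otimes> u [^] q \<oplus> u) \<otimes> \<delta> \<otimes> \<gamma> [^] l) ` K"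
    by (auto simp: U_sub_def)
  also have "\<dots> = w \<delta> (\<tau> \<otimes> \<delta>) l ` K"
    using gamma_in by (intro image_cong) (auto simp: w_def * K_carrier)
  finally show ?thesis .
qed

lemma V_sub_eq:
  assumes "\<eta> \<in> K"
  shows "V_sub R q K \<gamma> \<eta> l = w \<zero> \<eta> l ` K"
proof -
  have "V_sub R q K \<gamma> \<eta> l = (\<lambda>u. u \<oplus> \<eta> \<otimes> u [^] q \<otimes> \<gamma> [^] l) ` K"
    by (auto simp: V_sub_def)
  also have "\<dots> = w \<zero> \<eta> l ` K"
    using assms gamma_in by (intro image_cong) (auto simp: w_def K_carrier)
  finally show ?thesis .
qed

lemma K_eq: "K = w \<zero> \<zero> 1 ` K"
  using gamma_in by (auto simp: w_def K_carrier image_iff)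

text \<open>The triples in \<open>index\<close> with \<open>a \<noteq> \<zero>\<close> give the
  orbits of the \<open>U\<close> spaces with \<open>\<delta> = a\<close>; those with
  \<open>a = \<zero>\<close> give the orbits of the \<open>V\<close> spaces.\<close>

lemma code_eq:
  "(\<Union>\<tau>\<in>G. \<Union>\<delta>\<in>K - {\<zero>}. \<Union>l\<in>{1..e}. orbit R (U_sub R q K \<gamma> \<tau> \<delta> l))
    \<union> (\<Union>\<eta>\<in>G. \<Union>l\<in>{1..e}. orbit R (V_sub R q K \<gamma> \<eta> l)) \<union> orbit R K = code"
proof -
  have U: "(\<Union>\<tau>\<in>G. \<Union>\<delta>\<in>K - {\<zero>}. \<Union>l\<in>{1..e}. orbit R (U_sub R q K \<gamma> \<tau> \<delta> l))
      = (\<Union>\<tau>\<in>G. \<Union>\<delta>\<in>K - {\<zero>}. \<Union>l\<in>{1..e}. (\<lambda>\<alpha>. twisted (\<delta>, \<tau>, l, \<alpha>)) ` (carrier R - {\<zero>}))"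
    by (intro SUP_cong refl) (simp add: U_sub_eq G_memD orbit_w twisted_def twist_def)
  have V: "(\<Union>\<eta>\<in>G. \<Union>l\<in>{1..e}. orbit R (V_sub R q K \<gamma> \<eta> l))
      = (\<Union>\<eta>\<in>G. \<Union>l\<in>{1..e}. (\<lambda>\<alpha>. twisted (\<zero>, \<eta>, l, \<alpha>)) ` (carrier R - {\<zero>}))"
    by (intro SUP_cong refl) (simp add: V_sub_eq G_memD orbit_w twisted_def twist_def)
  have W: "orbit R K = straight ` (carrier R - {\<zero>})"
    by (subst K_eq) (simp add: orbit_w straight_def)
  have "index = (\<Union>\<tau>\<in>G. \<Union>\<delta>\<in>K - {\<zero>}. \<Union>l\<in>{1..e}. (\<lambda>\<alpha>. (\<delta>, \<tau>, l, \<alpha>)) ` (carrier R - {\<zero>}))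
      \<union> (\<Union>\<eta>\<in>G. \<Union>l\<in>{1..e}. (\<lambda>\<alpha>. (\<zero>, \<eta>, l, \<alpha>)) ` (carrier R - {\<zero>}))"
    (is "_ = ?A \<union> ?B")
  proof (intro subset_antisym subsetI)
    fix x assume "x \<in> index"
    then obtain a g l \<alpha> where "x = (a, g, l, \<alpha>)" "a \<in> K" "g \<in> G" "l \<in> {1..e}" "\<alpha> \<in> carrier R - {\<zero>}"
      unfolding index_def by blast
    then show "x \<in> ?A \<union> ?B" by (cases "a = \<zero>") blast+
  qed (use K_zero in \<open>auto simp: index_def\<close>)
  then show ?thesis unfolding U V W code_def by (simp add: image_UN image_Un image_image)
qed

lemma code_cyclic: "cyclic_code R code"
proof -
  let ?S = "(\<Union>\<tau>\<in>G. \<Union>\<delta>\<in>K - {\<zero>}. \<Union>l\<in>{1..e}. {U_sub R q K \<gamma> \<tau> \<delta> l})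
    \<union> (\<Union>\<eta>\<in>G. \<Union>l\<in>{1..e}. {V_sub R q K \<gamma> \<eta> l}) \<union> {K}"
  have "code = (\<Union>U\<in>?S. orbit R U)"
    unfolding code_eq[symmetric] by (simp only: UN_Un UN_UN_flatten UN_insert UN_empty Un_empty_right)
  then show ?thesis unfolding cyclic_code_def by (rule exI)
qed

end

theorem theorem3p4:
  fixes R :: "('a, 'b) ring_scheme" (structure)
    and q k n r e :: nat and \<xi> \<gamma> :: 'a and G :: "'a set"
  assumes field: "field R" and fin: "finite (carrier R)"
    and q_pp: "prime_power_nat q"
    and card_R: "card (carrier R) = q ^ n"
    and k2: "k \<ge> 2" and r2: "r > 2" and n_def: "n = r * k"
    and e_def: "e = nat \<lceil>real r / 2\<rceil> - 1"
    \<comment> \<open>\<xi> is a primitive element of F_(q^k)\<close>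
    and xi_in: "\<xi> \<in> subfield_of_order R (q ^ k)"
    and xi_prim: "subfield_of_order R (q ^ k) - {\<zero>} = {\<xi> [^] i | i :: nat. True}"
    \<comment> \<open>G: fixed coset representatives of F_(q^k)^* / \<langle>\<xi>^(q-1)\<rangle>\<close>
    and G_sub: "G \<subseteq> subfield_of_order R (q ^ k) - {\<zero>}"
    and G_rep: "\<forall>x \<in> subfield_of_order R (q ^ k) - {\<zero>}.
                  \<exists>!t. t \<in> G \<and> x \<otimes> inv t \<in> {(\<xi> [^] (q - 1)) [^] i | i :: nat. True}"
    \<comment> \<open>\<gamma> is a root of an irreducible polynomial of degree r over F_(q^k)\<close>
    and gamma_in: "\<gamma> \<in> carrier R"
    and gamma_root: "\<exists>p. polynomial (subfield_of_order R (q ^ k)) p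
                          \<and> pirreducible (subfield_of_order R (q ^ k)) p
                          \<and> degree p = r \<and> ring.eval R p \<gamma> = \<zero>"
  shows
    "let Fq = subfield_of_order R q; K = subfield_of_order R (q ^ k);
         C1 = (\<Union>\<tau>\<in>G. \<Union>\<delta>\<in>K - {\<zero>}. \<Union>l\<in>{1..e}. orbit R (U_sub R q K \<gamma> \<tau> \<delta> l));
         C2 = (\<Union>\<eta>\<in>G. \<Union>l\<in>{1..e}. orbit R (V_sub R q K \<gamma> \<eta> l));
         C3 = orbit R K;
         C = C1 \<union> C2 \<union> C3
     in cyclic_code R C \<and> constant_dim_code R Fq k C
        \<and> real (card C) = real e * real q ^ k * (real q ^ n - 1)
                          + (real q ^ n - 1) / (real q ^ k - 1)
        \<and> min_dist R Fq C = 2 * int k - 2"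
proof -
  interpret orbit_code R q k n r e \<xi> \<gamma> G
    by (rule orbit_code.intro[OF field orbit_code_axioms.intro]) (fact assms)+
  show ?thesis
    unfolding Let_def code_eq
    using code_cyclic code_subalgebra card_code min_dist_code
    unfolding constant_dim_code_def by (intro conjI ballI)
qed

end
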